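(* Let $V,W$ satisfy the standing assumptions (A1)--(A4) of the context. Let $n\ge2$, $T>0$, and let $(x^\circ,b^\circ)\in\mathbb{R}^n\times\{\pm1\}^n$ be such that $x_1^\circ<x_2^\circ<\dots<x_n^\circ$. Let $(x,b)$ be the (unique) solution on $[0,T]$ of the discrete problem with annihilation (see context) with initial datum $(x^\circ,b^\circ)$. Set $$\mu_n^{\pm,\circ}:=\frac1n\sum_{i:\,b_i^\circ=\pm1}\delta_{x_i^\circ},\quad \mu_n^\pm(t):=\frac1n\sum_{i:\,b_i^\circ=\pm1}\delta_{x_i(t)},\quad\kappa_n(t):=\frac1n\sum_{i=1}^nb_i^\circ\delta_{x_i(t)},\quad\tilde\mu_n^\pm(t):=[\kappa_n(t)]_\pm,$$ $\boldsymbol\mu_n:=(\mu_n^+,\mu_n^-)$, and let $n^+:=\#\{i:b_i^\circ=1\}$. Then: (i) for $t\in[0,T)$, $\displaystyle\tilde\mu_n^\pm(t)=\frac1n\sum_{i=1}^n[b_i(t)]_\pm\,\delta_{x_i(t)}$; (ii) $\boldsymbol\mu_n\in\mathrm{AC}^2(0,T;\mathcal P_2^m(\mathbb{R}\times\{\pm1\}))$ with $m=n^+/n$, and $$|\boldsymbol\mu_n'|_{\mathbf W}^2(t)\le\frac1n\sum_{i=1}^n\Big(\frac{\mathrm d}{\mathrm dt}x_i(t)\Big)^2\quad\text{for all }0<t<T;$$ (iii) $\boldsymbol\mu_n$ is a solution of the continuum problem (weak form, see context) with initial condition $\boldsymbol\mu_n^\circ=(\mu_n^{+,\circ},\mu_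n^{-,\circ})$.
   Context: **Assumptions on the potentials** $V:\mathbb{R}\setminus\{0\}\to\mathbb{R}$, $W:\mathbb{R}\to\mathbb{R}$: (A1) $V\in C^1(\mathbb{R}\setminus\{0\})$, $W\in C^1(\mathbb{R})$, $V'$ is locally Lipschitz on $\mathbb{R}\setminus\{0\}$, $W'$ is Lipschitz on $\mathbb{R}$. (A2) $V$ and $W$ are even. (A3) $V(r)\to+\infty$ as $r\to0$. (A4) $r\mapsto rV'(r)$ and $r\mapsto rW'(r)$ are in $L^\infty(\mathbb{R})$. Convention: $V'(0):=0$. **Discrete problem with annihilation.** Let $H$ be the Heaviside function on $\mathbb{R}\cup\{+\infty\}$ with $H(0)=0$, $H(+\infty)=1$. A solution on $[0,T]$ with initial datum $(x^\circ,b^\circ)$ is a map $(x,b):[0,T]\to\mathbb{R}^n\times\{-1,0,1\}^n$ such that: (a) $x\in\mathrm{Lip}([0,T];\mathbb{R}^n)$; (b) $(x(0),b(0))=(x^\circ,b^\circ)$ and, in the classical sense, for every $i$, $$\frac{\mathrm d}{\mathrm dt}x_i=-\frac1n\sum_{j:\,b_ib_j=1}V'(x_i-x_j)-\frac1n\sum_{j:\,b_ib_j=-1}W'(x_i-x_j)\quad\text{on }(0,T)\setminus T_{\mathrm{col}},$$ where $T_{\mathrm{col}}$ is the jump set of $b$; (c) there is a vector of collision times $\tau=(\tau_1,\dots,\tau_n)$ with $\tau_i\in(0,T)\cup\{+\infty\}$ such that, with $T_{\mathrm{col}}=\{\tau_i:1\le i\le n\}\setminus\{+\infty\}=\{t_1,\dots,t_K\}\subset(0,T)$,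 $0<t_1<\dots<t_K<T$, there holds $b_i(t)=b_i^\circ H(\tau_i-t)$ for all $i=1,\dots,n$; (d) with $t_0:=0$, for all $k=1,\dots,K$: $t_k=\inf\{t\in(0,T):\exists(i,j)\text{ such that }b_i(t_{k-1})b_j(t_{k-1})=-1\text{ and }x_i(t)=x_j(t)\}>t_{k-1}$; (e) at each time $t\in[0,T]$ there is a bijection $\alpha:\{i:b_i^\circ=1,\tau_i\le t\}\to\{j:b_j^\circ=-1,\tau_j\le t\}$ such that $x_i(t)=x_{\alpha(i)}(t)$. Comment accompanying this definition: $\tau_i$ is the time at which particle $x_i$ gets annihilated, and $\tau_i=+\infty$ means that particle $x_i$ does not collide in $(0,T)$; property (d) ensures that for each pair of two colliding particles at least one gets annihilated; property (e) ensures that both particles get annihilated, and that annihilation can only occur for colliding particles with non-zero charge. **Measure spaces.** For a signed measure (or number) $\kappa$, $[\kappa]_\pm$ denotes its positive/negative part. $\mathcal P(\mathbb{R}\times\{\pm1\})$ is the set of probability measures on $\mathbb{R}\times\{\pm1\}$, identified with pairs $\boldsymbol\mu=(\mu^+,\mu^-)$ of non-negative Borel measures on $\mathbb{R}$ with $\mu^+(\mathbb{R})+\mu^-(\mathbb{R})=1$ ($\mu^\pm$ being the part on $\mathbb{R}\times\{\pm1\}$). $\mathcal P_2(\mathbb{R}\times\{\pm1\})$ is the subset with finite second moments $\int x^2\,\mathrm d\mu^\pm<\infty$, and $\mathcal P_2^m(\mathbb{R}\times\{\pm1\})$ the subset of the latter with $\mu^+(\mathbb{R})=m$, $m\in[0,1]$.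 On $\mathcal P_2(\mathbb{R}\times\{\pm1\})$ the metric $\mathbf W$ is the 2-Wasserstein distance with respect to the distance $\mathsf d$ on $\mathbb{R}\times\{\pm1\}$ given by $\mathsf d^2((x,p),(y,q))=|x-y|^2+|p-q|$. $\mathrm{AC}^p(0,T;\cdot)$ denotes curves $\boldsymbol\mu$ with $\mathbf W(\boldsymbol\mu(s),\boldsymbol\mu(t))\le\int_s^t|f(r)|\,\mathrm dr$ for all $0<s\le t<T$ for some $f\in L^p(0,T)$; $\mathrm{AC}:=\mathrm{AC}^1$. For $\boldsymbol\mu\in\mathrm{AC}$ the metric derivative is $|\boldsymbol\mu'|_{\mathbf W}(t):=\lim_{s\to t}\mathbf W(\boldsymbol\mu(s),\boldsymbol\mu(t))/|s-t|$, which is defined for a.e. $t\in(0,T)$. **Continuum problem (weak form).** Given $\boldsymbol\rho^\circ=(\rho^{+,\circ},\rho^{-,\circ})\in\mathcal P_2(\mathbb{R}\times\{\pm1\})$, a solution with initial condition $\boldsymbol\rho^\circ$ is a curve $\boldsymbol\rho=(\rho^+,\rho^-)\in\mathrm{AC}(0,T;\mathcal P_2^m(\mathbb{R}\times\{\pm1\}))$, $m=\rho^{+,\circ}(\mathbb{R})$, with value $\boldsymbol\rho^\circ$ at $t=0$ and such that, with $\kappa(t):=\rho^+(t)-\rho^-(t)$, for all $\varphi^\pm\in C_c^\infty((0,T)\times\mathbb{R})$ (prime denoting the $x$-derivative), $$\begin{aligned}0=&\int_0^T\!\!\int_{\mathbb{R}}\partial_t\varphi^\pm(t,x)\,\mathrm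 d\rho^\pm(t)(x)\,\mathrm dt\\&-\frac12\int_0^T\!\!\iint_{\mathbb{R}\times\mathbb{R}}\big((\varphi^\pm)'(t,x)-(\varphi^\pm)'(t,y)\big)V'(x-y)\,\mathrm d([\kappa(t)]_\pm\otimes[\kappa(t)]_\pm)(x,y)\,\mathrm dt\\&-\int_0^T\!\!\int_{\mathbb{R}}(\varphi^\pm)'(t,x)\,(W'*[\kappa(t)]_\mp)(x)\,\mathrm d[\kappa(t)]_\pm(x)\,\mathrm dt.\end{aligned}$$
   Formalization: Property (d) is completed: after the last collision time t_K no two particles of opposite remaining charge meet in (0,T) (otherwise (i) can fail); the bound in (ii) is stated at every t in (0,T) where all dx_i/dt exist. *)

theory Defs
  imports "HOL-Analysis.Analysis"
begin

(* V is total in HOL, but only its values on the punctured line are ever used;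
   all occurrences of V' carry the convention V'(0) = 0. *)
definition dV :: "(real \<Rightarrow> real) \<Rightarrow> real \<Rightarrow> real" where
  "dV V r = (if r = 0 then 0 else deriv V r)"

definition essentially_bounded :: "(real \<Rightarrow> real) \<Rightarrow> bool" where
  "essentially_bounded f \<longleftrightarrow>
     f \<in> borel_measurable lborel \<and> (\<exists>C. AE r in lborel. \<bar>f r\<bar> \<le> C)"

(* The library's local_lipschitz is about time-dependent maps; here the map does not
   depend on the first argument. *)
definition admissible_potentials :: "(real \<Rightarrow> real) \<Rightarrow> (real \<Rightarrow> real) \<Rightarrow> bool" where
  "admissible_potentials V W \<longleftrightarrow>
     V C1_differentiable_on (- {0}) \<and>
     W C1_differentiable_on UNIV \<and>
     local_lipschitz (UNIV :: real set) (- {0}) (\<lambda>_. deriv V) \<and>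
     (\<exists>L. L-lipschitz_on UNIV (deriv W)) \<and>
     (\<forall>r. r \<noteq> 0 \<longrightarrow> V (- r) = V r) \<and>
     (\<forall>r. W (- r) = W r) \<and>
     filterlim V at_top (at 0) \<and>
     essentially_bounded (\<lambda>r. r * dV V r) \<and>
     essentially_bounded (\<lambda>r. r * deriv W r)"


(* Particles are indexed by {1..n}; a configuration is a function on nat of which only
   the values on {1..n} matter. *)

definition heaviside :: "ereal \<Rightarrow> int" where
  "heaviside r = (if 0 < r then 1 else 0)"

(* First time in (0,T) at which two particles with opposite charges at time s
   are at the same position; the infimum of the empty set is \<infinity>. *)
definition first_collision ::
  "nat \<Rightarrow> real \<Rightarrow> (real \<Rightarrow> nat \<Rightarrow> real) \<Rightarrow> (real \<Rightarrow> nat \<Rightarrow> int) \<Rightarrow> real \<Rightarrow> ereal" where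
  "first_collision n T x b s =
     (INF t\<in>{t \<in> {0<..<T}. \<exists>i\<in>{1..n}. \<exists>j\<in>{1..n}. b s i * b s j = -1 \<and> x t i = x t j}. ereal t)"

(* The condition first_collision n T x b (t K) = \<infinity> says that particles which are still
   charged after the last jump time t K do not collide with a particle of opposite charge in
   (0,T).  This is what makes tau i = \<infinity> mean that particle i does not collide; without it,
   particles of opposite charge could pass through each other after t K (W' is regular at 0),
   and the problem would not have a unique solution. *)
definition discrete_solution ::
  "(real \<Rightarrow> real) \<Rightarrow> (real \<Rightarrow> real) \<Rightarrow> nat \<Rightarrow> real \<Rightarrow> (nat \<Rightarrow> real) \<Rightarrow> (nat \<Rightarrow> int) \<Rightarrow>
   (real \<Rightarrow> nat \<Rightarrow> real) \<Rightarrow> (real \<Rightarrow> nat \<Rightarrow> int) \<Rightarrow> bool" where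
  "discrete_solution V W n T x0 b0 x b \<longleftrightarrow>
     (\<forall>t\<in>{0..T}. \<forall>i\<in>{1..n}. b t i \<in> {-1, 0, 1}) \<and>
     (\<forall>i\<in>{1..n}. \<exists>L. L-lipschitz_on {0..T} (\<lambda>t. x t i)) \<and>
     (\<forall>i\<in>{1..n}. x 0 i = x0 i \<and> b 0 i = b0 i) \<and>
     (\<exists>(tau :: nat \<Rightarrow> ereal) (K :: nat) (t :: nat \<Rightarrow> real).
        (\<forall>i\<in>{1..n}. tau i \<in> ereal ` {0<..<T} \<union> {\<infinity>}) \<and>
        t ` {1..K} = {s. \<exists>i\<in>{1..n}. tau i = ereal s} \<and>
        t 0 = 0 \<and> strict_mono_on {0..K} t \<and>
        (\<forall>s \<in> {0<..<T} - t ` {1..K}. \<forall>i\<in>{1..n}.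
           ((\<lambda>r. x r i) has_real_derivative
              - (1 / real n) * (\<Sum>j | j \<in> {1..n} \<and> b s i * b s j = 1. dV V (x s i - x s j))
              - (1 / real n) * (\<Sum>j | j \<in> {1..n} \<and> b s i * b s j = -1. deriv W (x s i - x s j)))
           (at s)) \<and>
        (\<forall>s\<in>{0..T}. \<forall>i\<in>{1..n}. b s i = b0 i * heaviside (tau i - ereal s)) \<and>
        (\<forall>k\<in>{1..K}. ereal (t k) = first_collision n T x b (t (k - 1)) \<and> t (k - 1) < t k) \<and>
        first_collision n T x b (t K) = \<infinity> \<and>
        (\<forall>s\<in>{0..T}. \<exists>\<alpha>.
           bij_betw \<alpha> {i \<in> {1..n}. b0 i = 1 \<and> tau i \<le> ereal s}
                      {j \<in> {1..n}. b0 j = -1 \<and> tau j \<le> ereal s} \<and>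
           (\<forall>i \<in> {i \<in> {1..n}. b0 i = 1 \<and> tau i \<le> ereal s}. x s i = x s (\<alpha> i))))"


(* A finite signed Borel measure is represented by its values on Borel sets.  Its positive and
   negative parts in the Jordan decomposition are its upper and lower variations. *)
definition pos_part :: "(real set \<Rightarrow> real) \<Rightarrow> real measure" where
  "pos_part \<kappa> = measure_of UNIV (sets borel)
     (\<lambda>A. SUP B\<in>{B \<in> sets borel. B \<subseteq> A}. ennreal (\<kappa> B))"

definition neg_part :: "(real set \<Rightarrow> real) \<Rightarrow> real measure" where
  "neg_part \<kappa> = pos_part (\<lambda>A. - \<kappa> A)"

(* The measure \<Sum>i\<in>I. w i * \<delta>(y i). *)
definition dirac_sum :: "nat set \<Rightarrow> (nat \<Rightarrow> real) \<Rightarrow> (nat \<Rightarrow> real) \<Rightarrow> real measure" where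
  "dirac_sum I w y = distr (point_measure I (\<lambda>i. ennreal (w i))) borel y"

(* Measures on \<real> \<times> {-1,1} are represented by the pair (part on \<real> \<times> {1}, part on \<real> \<times> {-1}). *)
type_synonym charged_measure = "real measure \<times> real measure"

definition P2 :: "charged_measure set" where
  "P2 = {(\<mu>, \<nu>). sets \<mu> = sets borel \<and> sets \<nu> = sets borel \<and>
          emeasure \<mu> UNIV + emeasure \<nu> UNIV = 1 \<and>
          (\<integral>\<^sup>+ x. ennreal (x\<^sup>2) \<partial>\<mu>) < \<infinity> \<and> (\<integral>\<^sup>+ x. ennreal (x\<^sup>2) \<partial>\<nu>) < \<infinity>}"

definition P2m :: "real \<Rightarrow> charged_measure set" where
  "P2m m = {\<mu> \<in> P2. measure (fst \<mu>) UNIV = m}"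

definition charged_line :: "(real \<times> int) measure" where
  "charged_line = borel \<Otimes>\<^sub>M count_space {-1, 1}"

definition glue :: "charged_measure \<Rightarrow> (real \<times> int) measure" where
  "glue \<mu> = measure_of (space charged_line) (sets charged_line)
     (\<lambda>A. emeasure (fst \<mu>) {x. (x, 1) \<in> A} + emeasure (snd \<mu>) {x. (x, -1) \<in> A})"

definition couplings ::
  "charged_measure \<Rightarrow> charged_measure \<Rightarrow> ((real \<times> int) \<times> (real \<times> int)) measure set" where
  "couplings \<mu> \<nu> = {\<gamma>. sets \<gamma> = sets (charged_line \<Otimes>\<^sub>M charged_line) \<and>
     distr \<gamma> charged_line fst = glue \<mu> \<and> distr \<gamma> charged_line snd = glue \<nu>}"

definition cost :: "(real \<times> int) \<times> (real \<times> int) \<Rightarrow> real" where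
  "cost = (\<lambda>((x, p), (y, q)). \<bar>x - y\<bar>\<^sup>2 + of_int \<bar>p - q\<bar>)"

(* Meaningful on P2 only, where the infimum is finite. *)
definition wasserstein :: "charged_measure \<Rightarrow> charged_measure \<Rightarrow> real" where
  "wasserstein \<mu> \<nu> = sqrt (enn2real (INF \<gamma>\<in>couplings \<mu> \<nu>. \<integral>\<^sup>+ z. ennreal (cost z) \<partial>\<gamma>))"

definition AC_curve ::
  "real \<Rightarrow> real \<Rightarrow> charged_measure set \<Rightarrow> (real \<Rightarrow> charged_measure) \<Rightarrow> bool" where
  "AC_curve p T X \<mu> \<longleftrightarrow>
     (\<forall>t\<in>{0<..<T}. \<mu> t \<in> X) \<and>
     (\<exists>f :: real \<Rightarrow> real.
        set_borel_measurable lborel {0<..<T} f \<and>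
        set_integrable lborel {0<..<T} (\<lambda>r. \<bar>f r\<bar> powr p) \<and>
        (\<forall>s t. 0 < s \<and> s \<le> t \<and> t < T \<longrightarrow>
           wasserstein (\<mu> s) (\<mu> t) \<le> (LBINT r:{s..t}. \<bar>f r\<bar>)))"

definition has_metric_derivative ::
  "(real \<Rightarrow> charged_measure) \<Rightarrow> real \<Rightarrow> real \<Rightarrow> bool" where
  "has_metric_derivative \<mu> D t \<longleftrightarrow>
     ((\<lambda>s. wasserstein (\<mu> s) (\<mu> t) / \<bar>s - t\<bar>) \<longlongrightarrow> D) (at t)"


definition dt :: "(real \<Rightarrow> real \<Rightarrow> real) \<Rightarrow> real \<Rightarrow> real \<Rightarrow> real" where
  "dt \<phi> t x = deriv (\<lambda>s. \<phi> s x) t"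

definition dx :: "(real \<Rightarrow> real \<Rightarrow> real) \<Rightarrow> real \<Rightarrow> real \<Rightarrow> real" where
  "dx \<phi> t x = deriv (\<lambda>y. \<phi> t y) x"

primrec Ck :: "nat \<Rightarrow> (real \<Rightarrow> real \<Rightarrow> real) \<Rightarrow> bool" where
  "Ck 0 \<phi> \<longleftrightarrow> continuous_on UNIV (\<lambda>(t, x). \<phi> t x)"
| "Ck (Suc k) \<phi> \<longleftrightarrow> continuous_on UNIV (\<lambda>(t, x). \<phi> t x) \<and>
     (\<forall>t x. (\<lambda>s. \<phi> s x) differentiable (at t) \<and> (\<lambda>y. \<phi> t y) differentiable (at x)) \<and>
     Ck k (dt \<phi>) \<and> Ck k (dx \<phi>)"

(* Elements of C_c^\<infinity>((0,T) \<times> \<real>), extended by 0 to the plane. *)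
definition test_functions :: "real \<Rightarrow> (real \<Rightarrow> real \<Rightarrow> real) set" where
  "test_functions T = {\<phi>. (\<forall>k. Ck k \<phi>) \<and>
     (\<exists>S. compact S \<and> S \<subseteq> {0<..<T} \<times> UNIV \<and> (\<forall>t x. (t, x) \<notin> S \<longrightarrow> \<phi> t x = 0))}"

(* The equation for one sign: \<rho> is the density of that sign, \<eta> the part of \<kappa> of that sign and
   \<zeta> the part of \<kappa> of the opposite sign. *)
definition weak_equation ::
  "(real \<Rightarrow> real) \<Rightarrow> (real \<Rightarrow> real) \<Rightarrow> real \<Rightarrow>
   (real \<Rightarrow> real measure) \<Rightarrow> (real \<Rightarrow> real measure) \<Rightarrow> (real \<Rightarrow> real measure) \<Rightarrow> bool" where
  "weak_equation V W T \<rho> \<eta> \<zeta> \<longleftrightarrow>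
     (\<forall>\<phi>\<in>test_functions T.
        0 = (LBINT t:{0<..<T}. (LINT x|\<rho> t. dt \<phi> t x))
          - 1 / 2 * (LBINT t:{0<..<T}. (LINT z|(\<eta> t \<Otimes>\<^sub>M \<eta> t).
               (dx \<phi> t (fst z) - dx \<phi> t (snd z)) * dV V (fst z - snd z)))
          - (LBINT t:{0<..<T}. (LINT x|\<eta> t.
               dx \<phi> t x * (LINT y|\<zeta> t. deriv W (x - y)))))"

definition signed_difference :: "charged_measure \<Rightarrow> real set \<Rightarrow> real" where
  "signed_difference \<mu> A = measure (fst \<mu>) A - measure (snd \<mu>) A"

(* A curve in AC(0,T) has a continuous extension to t = 0; its value there is the initial
   condition. *)
definition continuum_solution ::
  "(real \<Rightarrow> real) \<Rightarrow> (real \<Rightarrow> real) \<Rightarrow> real \<Rightarrow> charged_measure \<Rightarrow> (real \<Rightarrow> charged_measure) \<Rightarrow> bool"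
where
  "continuum_solution V W T \<rho>0 \<rho> \<longleftrightarrow>
     \<rho>0 \<in> P2 \<and>
     AC_curve 1 T (P2m (measure (fst \<rho>0) UNIV)) \<rho> \<and>
     \<rho> 0 = \<rho>0 \<and> ((\<lambda>t. wasserstein (\<rho> t) \<rho>0) \<longlongrightarrow> 0) (at_right 0) \<and>
     weak_equation V W T (\<lambda>t. fst (\<rho> t))
       (\<lambda>t. pos_part (signed_difference (\<rho> t))) (\<lambda>t. neg_part (signed_difference (\<rho> t))) \<and>
     weak_equation V W T (\<lambda>t. snd (\<rho> t))
       (\<lambda>t. neg_part (signed_difference (\<rho> t))) (\<lambda>t. pos_part (signed_difference (\<rho> t)))"


definition empirical :: "nat \<Rightarrow> (nat \<Rightarrow> int) \<Rightarrow> (nat \<Rightarrow> real) \<Rightarrow> charged_measure" where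
  "empirical n b0 y =
     (dirac_sum {i \<in> {1..n}. b0 i = 1} (\<lambda>_. 1 / real n) y,
      dirac_sum {i \<in> {1..n}. b0 i = -1} (\<lambda>_. 1 / real n) y)"

definition signed_empirical :: "nat \<Rightarrow> (nat \<Rightarrow> int) \<Rightarrow> (nat \<Rightarrow> real) \<Rightarrow> real set \<Rightarrow> real" where
  "signed_empirical n b0 y A = (1 / real n) * (\<Sum>i=1..n. of_int (b0 i) * indicator A (y i))"

end

theory Submission
  imports Defs
begin

text \<open>
  The bijections in the definition of a solution superpose annihilated particles in pairs of opposite
  charge, so these cancel in \<open>\<kappa>\<close>; charged particles of opposite sign sit at different positions before
  the next collision time. Hence the Jordan decomposition of \<open>\<kappa>\<close> consists of the charged particles.

  Moving every particle along its own trajectory is a coupling, which bounds the Wasserstein distance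
  from above. For \<open>s\<close> close to \<open>t\<close> the atom of \<open>\<mu>(t)\<close> nearest to \<open>x\<^sub>i(s)\<close> is \<open>x\<^sub>i(t)\<close>, so this coupling is
  optimal and the metric derivative exists, with equality in the claimed bound.

  The weak equation is the fundamental theorem of calculus for the sum of \<open>\<phi>(t, x\<^sub>i(t))\<close> over one sign,
  which is differentiable off the finitely many collision times; oddness of \<open>V'\<close> symmetrises the
  interaction term, and boundedness of \<open>r V'(r)\<close> makes it integrable.
\<close>

section \<open>Finite sums of Dirac measures\<close>

lemma sets_dirac_sum [simp, measurable_cong]: "sets (dirac_sum I w y) = sets borel"
  by (simp add: dirac_sum_def)

lemma space_dirac_sum [simp]: "space (dirac_sum I w y) = UNIV"
  by (simp add: dirac_sum_def)

lemma dirac_sum_cong: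
  assumes "\<And>i. i \<in> I \<Longrightarrow> w i = v i" "\<And>i. i \<in> I \<Longrightarrow> y i = z i"
  shows "dirac_sum I w y = dirac_sum I v z"
proof -
  have "point_measure I (\<lambda>i. ennreal (w i)) = point_measure I (\<lambda>i. ennreal (v i))"
    unfolding point_measure_def by (rule density_cong) (use assms in \<open>auto simp: AE_count_space\<close>)
  then show ?thesis
    unfolding dirac_sum_def
    by (intro distr_cong) (use assms in \<open>auto simp: space_point_measure\<close>)
qed

lemma nn_integral_dirac_sum:
  assumes "finite I" "f \<in> borel_measurable borel"
  shows "(\<integral>\<^sup>+ x. f x \<partial>dirac_sum I w y) = (\<Sum>i\<in>I. ennreal (w i) * f (y i))"
  unfolding dirac_sum_def using assms
  by (subst nn_integral_distr) (auto simp: nn_integral_point_measure_finite)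

lemma emeasure_dirac_sum:
  assumes "finite I" "A \<in> sets borel"
  shows "emeasure (dirac_sum I w y) A = (\<Sum>i\<in>I. ennreal (w i) * indicator A (y i))"
  using nn_integral_dirac_sum[of I "indicator A" w y] assms by simp

lemma integral_dirac_sum:
  fixes f :: "real \<Rightarrow> real"
  assumes "finite I" "\<And>i. i \<in> I \<Longrightarrow> 0 \<le> w i" "f \<in> borel_measurable borel"
  shows "(LINT x|dirac_sum I w y. f x) = (\<Sum>i\<in>I. w i * f (y i))"
  unfolding dirac_sum_def using assms
  by (subst integral_distr) (auto simp: lebesgue_integral_point_measure_finite)

lemma measure_dirac_sum:
  assumes "finite I" "\<And>i. i \<in> I \<Longrightarrow> 0 \<le> w i" "A \<in> sets borel"
  shows "measure (dirac_sum I w y) A = (\<Sum>i\<in>I. w i * indicator A (y i))"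
  using integral_dirac_sum[of I w "indicator A" y] assms by simp

lemma finite_measure_dirac_sum:
  assumes "finite I"
  shows "finite_measure (dirac_sum I w y)"
proof
  show "emeasure (dirac_sum I w y) (space (dirac_sum I w y)) \<noteq> \<infinity>"
    using assms by (simp add: emeasure_dirac_sum ennreal_mult_less_top)
qed

text \<open>Against finitely many atoms every Borel function is integrable, so Fubini needs no bound
  on \<open>f\<close>; this covers the kernel built from \<open>dV V\<close>, which is singular at
  0.\<close>

lemma integral_pair_dirac_sum:
  fixes f :: "real \<times> real \<Rightarrow> real"
  assumes fin: "finite I" "finite J"
    and nonneg: "\<And>i. i \<in> I \<Longrightarrow> 0 \<le> w i" "\<And>j. j \<in> J \<Longrightarrow> 0 \<le> v j"
    and f [measurable]: "f \<in> borel_measurable (borel \<Otimes>\<^sub>M borel)"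
  shows "(LINT p|(dirac_sum I w y \<Otimes>\<^sub>M dirac_sum J v z). f p) = (\<Sum>i\<in>I. \<Sum>j\<in>J. w i * v j * f (y i, z j))"
proof -
  let ?M = "dirac_sum I w y" and ?N = "dirac_sum J v z"
  interpret M: finite_measure ?M using fin by (intro finite_measure_dirac_sum)
  interpret N: finite_measure ?N using fin by (intro finite_measure_dirac_sum)
  interpret pair_sigma_finite ?M ?N ..
  have f' [measurable]: "f \<in> borel_measurable (?M \<Otimes>\<^sub>M ?N)"
    by measurable
  have "integrable (?M \<Otimes>\<^sub>M ?N) f"
  proof (rule integrableI_bounded)
    have "(\<integral>\<^sup>+ p. ennreal (norm (f p)) \<partial>(?M \<Otimes>\<^sub>M ?N)) = (\<integral>\<^sup>+ x. \<integral>\<^sup>+ y. ennreal (norm (f (x, y))) \<partial>?N \<partial>?M)"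
      by (subst N.nn_integral_fst) simp_all
    also have "\<dots> = (\<Sum>i\<in>I. ennreal (w i) * (\<Sum>j\<in>J. ennreal (v j) * ennreal (norm (f (y i, z j)))))"
      using fin by (simp add: nn_integral_dirac_sum)
    also have "\<dots> < \<infinity>"
      using fin by (simp add: ennreal_mult_less_top)
    finally show "(\<integral>\<^sup>+ p. ennreal (norm (f p)) \<partial>(?M \<Otimes>\<^sub>M ?N)) < \<infinity>" .
  qed simp
  then have "(LINT p|(?M \<Otimes>\<^sub>M ?N). f p) = (LINT x|?M. LINT y|?N. f (x, y))"
    by (rule integral_fst'[symmetric])
  also have "\<dots> = (\<Sum>i\<in>I. w i * (\<Sum>j\<in>J. v j * f (y i, z j)))"
    using fin nonneg by (simp add: integral_dirac_sum)
  finally show ?thesis by (simp add: sum_distrib_left mult.assoc)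
qed

text \<open>The supremum over Borel subsets of \<open>A\<close> is attained at the part of
  \<open>A\<close> occupied by atoms of positive weight. Hypothesis \<open>sep\<close> keeps
  negative atoms out of this part; atoms of the same sign may share a position.\<close>

lemma pos_part_dirac_sum:
  assumes fin: "finite I"
    and \<kappa>: "\<And>A. A \<in> sets borel \<Longrightarrow> \<kappa> A = (\<Sum>i\<in>I. a i * indicator A (y i))"
    and sep: "\<And>i j. i \<in> I \<Longrightarrow> j \<in> I \<Longrightarrow> a i > 0 \<Longrightarrow> a j < 0 \<Longrightarrow> y i \<noteq> y j"
  shows "pos_part \<kappa> = dirac_sum I (\<lambda>i. max 0 (a i)) y"
proof -
  let ?M = "dirac_sum I (\<lambda>i. max 0 (a i)) y"
  have eq: "(SUP B\<in>{B \<in> sets borel. B \<subseteq> A}. ennreal (\<kappa> B)) = emeasure ?M A"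
    if A: "A \<in> sets borel" for A
  proof -
    have val: "emeasure ?M A = ennreal (\<Sum>i\<in>I. max 0 (a i) * indicator A (y i))"
      using A fin
      by (simp add: finite_measure.emeasure_eq_measure[OF finite_measure_dirac_sum] measure_dirac_sum)
    show ?thesis
    proof (rule antisym)
      show "(SUP B\<in>{B \<in> sets borel. B \<subseteq> A}. ennreal (\<kappa> B)) \<le> emeasure ?M A"
        unfolding val
      proof (rule SUP_least)
        fix B assume B: "B \<in> {B \<in> sets borel. B \<subseteq> A}"
        then have "\<kappa> B = (\<Sum>i\<in>I. a i * indicator B (y i))" using \<kappa> by simp
        also have "\<dots> \<le> (\<Sum>i\<in>I. max 0 (a i) * indicator A (y i))"
          using B by (intro sum_mono) (auto simp: indicator_def)
        finally show "ennreal (\<kappa> B) \<le> ennreal (\<Sum>i\<in>I. max 0 (a i) * indicator A (y i))"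
          by (rule ennreal_leI)
      qed
      let ?B = "A \<inter> y ` {i \<in> I. a i > 0}"
      have B: "?B \<in> sets borel"
        using A fin by (intro sets.Int) (auto intro!: borel_closed finite_imp_closed)
      have "a i * indicator ?B (y i) = max 0 (a i) * indicator A (y i)" if "i \<in> I" for i
        using sep[OF _ that] that
        by (cases "a i" "0::real" rule: linorder_cases) (fastforce simp: indicator_def)+
      then have "\<kappa> ?B = (\<Sum>i\<in>I. max 0 (a i) * indicator A (y i))"
        using \<kappa>[OF B] by simp
      then show "emeasure ?M A \<le> (SUP B\<in>{B \<in> sets borel. B \<subseteq> A}. ennreal (\<kappa> B))"
        unfolding val using B by (intro SUP_upper2[of ?B]) auto
    qed
  qed
  \<comment> \<open>\<open>measure_of\<close> sees only the values on Borel sets, so agreement there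
    identifies the two measures, and countable additivity is inherited from
    \<open>?M\<close>.\<close>
  have "pos_part \<kappa> = measure_of UNIV (sets borel) (emeasure ?M)"
    unfolding pos_part_def
    by (rule measure_of_eq) (use eq in \<open>auto simp: sets.sigma_sets_eq[of borel, simplified]\<close>)
  also have "\<dots> = ?M"
    using measure_of_of_measure[of ?M] by simp
  finally show ?thesis .
qed

section \<open>Annihilation and the Jordan decomposition\<close>

text \<open>Since H(0) = 0 the inequality is strict: a particle is already uncharged at its own
  collision time, and one with infinite collision time keeps its charge.\<close>

lemma heaviside_diff: "heaviside (r - ereal s) = of_bool (ereal s < r)"
  by (cases r) (auto simp: heaviside_def)

text \<open>Extracts what the later arguments use, with the collision times as \<open>S\<close>.
  Separation of opposite charges stops short of \<open>T\<close>, because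
  \<open>first_collision\<close> inspects only the open interval; cancellation includes
  \<open>T\<close>.\<close>

lemma discrete_solution_facts:
  assumes sol: "discrete_solution V W n T x0 b0 x b" and T: "T > 0"
    and b0: "\<forall>i\<in>{1..n}. b0 i \<in> {-1, 1}" and inj: "inj_on x0 {1..n}"
  obtains tau S where
    "finite S"
    "\<And>s i. s \<in> {0..T} \<Longrightarrow> i \<in> {1..n} \<Longrightarrow> b s i = b0 i * of_bool (ereal s < tau i)"
    "\<And>s i j. s \<in> {0..<T} \<Longrightarrow> i \<in> {1..n} \<Longrightarrow> j \<in> {1..n} \<Longrightarrow> b s i * b s j = -1 \<Longrightarrow> x s i \<noteq> x s j"
    "\<And>s (f :: real \<Rightarrow> real). s \<in> {0..T} \<Longrightarrow>
       (\<Sum>i=1..n. of_int (b0 i) * f (x s i)) = (\<Sum>i=1..n. of_int (b s i) * f (x s i))"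
    "\<And>s i. s \<in> {0<..<T} - S \<Longrightarrow> i \<in> {1..n} \<Longrightarrow>
       ((\<lambda>r. x r i) has_real_derivative
          - (1 / real n) * (\<Sum>j | j \<in> {1..n} \<and> b s i * b s j = 1. dV V (x s i - x s j))
          - (1 / real n) * (\<Sum>j | j \<in> {1..n} \<and> b s i * b s j = -1. deriv W (x s i - x s j))) (at s)"
proof -
  from sol have init: "\<And>i. i \<in> {1..n} \<Longrightarrow> x 0 i = x0 i"
    unfolding discrete_solution_def by blast
  from sol obtain tau and K :: nat and t where
    t_mono: "strict_mono_on {0..K} t" and t0: "t 0 = (0::real)"
    and t_tau: "t ` {1..K} = {s. \<exists>i\<in>{1..n}. tau i = ereal s}"
    and der: "\<forall>s \<in> {0<..<T} - t ` {1..K}. \<forall>i\<in>{1..n}.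
       ((\<lambda>r. x r i) has_real_derivative
          - (1 / real n) * (\<Sum>j | j \<in> {1..n} \<and> b s i * b s j = 1. dV V (x s i - x s j))
          - (1 / real n) * (\<Sum>j | j \<in> {1..n} \<and> b s i * b s j = -1. deriv W (x s i - x s j))) (at s)"
    and b: "\<forall>s\<in>{0..T}. \<forall>i\<in>{1..n}. b s i = b0 i * heaviside (tau i - ereal s)"
    and coll: "\<forall>k\<in>{1..K}. ereal (t k) = first_collision n T x b (t (k - 1)) \<and> t (k - 1) < t k"
    and coll_last: "first_collision n T x b (t K) = \<infinity>"
    and pairing: "\<forall>s\<in>{0..T}. \<exists>\<alpha>.
           bij_betw \<alpha> {i \<in> {1..n}. b0 i = 1 \<and> tau i \<le> ereal s}
                      {j \<in> {1..n}. b0 j = -1 \<and> tau j \<le> ereal s} \<and>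
           (\<forall>i \<in> {i \<in> {1..n}. b0 i = 1 \<and> tau i \<le> ereal s}. x s i = x s (\<alpha> i))"
    unfolding discrete_solution_def by (elim conjE exE) (rule that)
  have b': "b s i = b0 i * of_bool (ereal s < tau i)" if "s \<in> {0..T}" "i \<in> {1..n}" for s i
    using b that by (simp add: heaviside_diff)
  have sep: "x s i \<noteq> x s j"
    if s: "s \<in> {0..<T}" and ij: "i \<in> {1..n}" "j \<in> {1..n}" and opp: "b s i * b s j = -1" for s i j
  proof
    assume eq: "x s i = x s j"
    show False
    \<comment> \<open>Time 0 lies outside the interval of \<open>first_collision\<close>; there
      distinctness of the initial positions forces \<open>i = j\<close>, and a square cannot be
      -1.\<close>
    proof (cases "s = 0")
      case True
      with eq have "x0 i = x0 j" by (simp only: init ij)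
      with inj ij have "i = j" by (auto dest: inj_onD)
      with opp show False using zero_le_square[of "b s j"] by simp
    next
      case False
      \<comment> \<open>\<open>t k\<close> is the last jump time not after \<open>s\<close>; the
        entry \<open>t 0 = 0\<close> serves when nothing has jumped yet.\<close>
      define k where "k = Max {k \<in> {0..K}. t k \<le> s}"
      have "k \<in> {k \<in> {0..K}. t k \<le> s}"
        unfolding k_def by (rule Max_in) (use s t0 in auto)
      then have k: "k \<le> K" "t k \<le> s" by auto
      have k_max: "s < t m" if "k < m" "m \<le> K" for m
        using that Max_ge[of "{k \<in> {0..K}. t k \<le> s}" m] unfolding k_def[symmetric]
        by (cases "s < t m") auto
      have "t 0 \<le> t k"
        using t_mono k by (cases k) (auto simp: strict_mono_on_def less_imp_le)
      then have tk: "t k \<in> {0..T}" using t0 k s by auto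
      \<comment> \<open>Every finite \<open>tau m\<close> is some \<open>t l\<close>, and none of
        these lies after \<open>t k\<close> and up to \<open>s\<close>. Hence the charges at
        \<open>s\<close> are those at \<open>t k\<close>, to which the collision condition
        refers.\<close>
      have alive: "ereal (t k) < tau m \<longleftrightarrow> ereal s < tau m" if m: "m \<in> {1..n}" for m
      proof
        assume *: "ereal (t k) < tau m"
        show "ereal s < tau m"
        proof (cases "tau m")
          case (real r)
          with m have "r \<in> t ` {1..K}" unfolding t_tau by auto
          then obtain l where l: "l \<in> {1..K}" "r = t l" by auto
          have "\<not> l \<le> k"
            using strict_mono_on_leD[OF t_mono, of l k] * real l k by auto
          with k_max[of l] l real show ?thesis by auto
        qed (use * in auto)
      next
        assume "ereal s < tau m"
        then show "ereal (t k) < tau m" using k by (meson ereal_less_eq(3) le_less_trans)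
      qed
      have "b (t k) m = b s m" if "m \<in> {1..n}" for m
        using b'[OF tk that] b'[of s m] alive[OF that] s that by simp
      then have "b (t k) i * b (t k) j = -1" using opp ij by simp
      \<comment> \<open>A meeting at \<open>s\<close> would put the first collision for the charges
        at \<open>t k\<close> no later than \<open>s\<close>, although it happens at
        \<open>t (Suc k)\<close>, or never if \<open>k = K\<close>.\<close>
      then have "first_collision n T x b (t k) \<le> ereal s"
        unfolding first_collision_def using s False eq ij
        by (intro INF_lower CollectI conjI bexI[of _ i] bexI[of _ j]) auto
      moreover have "ereal s < first_collision n T x b (t k)"
      proof (cases "k = K")
        case True
        then show ?thesis using coll_last by simp
      next
        case False
        then have "ereal s < ereal (t (Suc k))" using k k_max[of "Suc k"] by simp
        also have "\<dots> = first_collision n T x b (t k)"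
          using bspec[OF coll, of "Suc k"] False k by simp
        finally show ?thesis .
      qed
      ultimately show False by simp
    qed
  qed
  \<comment> \<open>Only annihilated particles contribute to the difference, since the others have
    \<open>b s i = b0 i\<close>. The bijection matches their two signs at equal positions, so their
    total vanishes for every \<open>f\<close>.\<close>
  have cancel: "(\<Sum>i=1..n. of_int (b0 i) * f (x s i)) = (\<Sum>i=1..n. of_int (b s i) * f (x s i))"
    if s: "s \<in> {0..T}" for s and f :: "real \<Rightarrow> real"
  proof -
    let ?P = "{i \<in> {1..n}. b0 i = 1 \<and> tau i \<le> ereal s}"
    let ?N = "{j \<in> {1..n}. b0 j = -1 \<and> tau j \<le> ereal s}"
    obtain \<alpha> where \<alpha>: "bij_betw \<alpha> ?P ?N" "\<And>i. i \<in> ?P \<Longrightarrow> x s i = x s (\<alpha> i)"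
      using bspec[OF pairing s] by blast
    have "(\<Sum>i=1..n. of_int (b0 i) * f (x s i)) - (\<Sum>i=1..n. of_int (b s i) * f (x s i)) =
        (\<Sum>i=1..n. of_bool (i \<in> ?P) * f (x s i) - of_bool (i \<in> ?N) * f (x s i))"
      unfolding sum_subtractf[symmetric]
    proof (rule sum.cong[OF refl])
      fix i assume i: "i \<in> {1..n}"
      then have "b0 i = 1 \<or> b0 i = -1" using b0 by auto
      then show "of_int (b0 i) * f (x s i) - of_int (b s i) * f (x s i) =
          of_bool (i \<in> ?P) * f (x s i) - of_bool (i \<in> ?N) * f (x s i)"
        using i b'[OF s i] by (auto simp: not_le)
    qed
    also have "\<dots> = (\<Sum>i\<in>?P. f (x s i)) - (\<Sum>i\<in>?N. f (x s i))"
      unfolding sum_subtractf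
      by (intro arg_cong2[where f = "(-)"] sum.mono_neutral_cong_right) auto
    also have "(\<Sum>i\<in>?N. f (x s i)) = (\<Sum>i\<in>?P. f (x s (\<alpha> i)))"
      using sum.reindex_bij_betw[OF \<alpha>(1), of "\<lambda>i. f (x s i)"] by simp
    also have "\<dots> = (\<Sum>i\<in>?P. f (x s i))"
      using \<alpha>(2) by (intro sum.cong) auto
    finally show ?thesis by simp
  qed
  show thesis
  proof (rule that)
    show "finite (t ` {1..K})" by simp
  qed (fact b' | fact sep | fact cancel | fact der[rule_format])+
qed

text \<open>Restricted to Borel sets because \<open>measure\<close> takes a default value elsewhere;
  this suffices, as \<open>pos_part\<close> evaluates its argument on Borel sets only.\<close>

lemma signed_difference_empirical:
  assumes "\<And>i. i \<in> {1..n} \<Longrightarrow> b0 i \<in> {-1, 1}" and A: "A \<in> sets borel"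
  shows "signed_difference (empirical n b0 y) A = signed_empirical n b0 y A"
proof -
  have "1 / real n * (of_int (b0 i) * indicator A (y i)) =
      of_bool (b0 i = 1) * indicator A (y i) / real n - of_bool (b0 i = -1) * indicator A (y i) / real n"
    if "i \<in> {1..n}" for i
    using assms(1)[OF that] by auto
  then have "signed_empirical n b0 y A =
      (\<Sum>i=1..n. of_bool (b0 i = 1) * indicator A (y i) / real n)
      - (\<Sum>i=1..n. of_bool (b0 i = -1) * indicator A (y i) / real n)"
    unfolding signed_empirical_def sum_distrib_left sum_subtractf[symmetric]
    by (intro sum.cong refl) (simp add: mult_ac)
  also have "\<dots> = signed_difference (empirical n b0 y) A"
    unfolding signed_difference_def empirical_def
    using A by (auto simp: measure_dirac_sum intro!: arg_cong2[where f = "(-)"] sum.mono_neutral_cong_right)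
  finally show ?thesis by simp
qed

text \<open>Serves both signs: \<open>c\<close> will be the current charges or their negatives. For
  values in {-1, 0, 1}, opposite signs mean product -1, the form in which separation is
  available.\<close>

lemma pos_part_particles:
  assumes c: "\<And>A. A \<in> sets borel \<Longrightarrow> \<kappa> A = (\<Sum>i=1..n. (1 / real n) * of_int (c i) * indicator A (y i))"
    and sep: "\<And>i j. i \<in> {1..n} \<Longrightarrow> j \<in> {1..n} \<Longrightarrow> c i * c j = -1 \<Longrightarrow> y i \<noteq> y j"
    and range: "\<And>i. i \<in> {1..n} \<Longrightarrow> c i \<in> {-1, 0, 1}"
  shows "pos_part \<kappa> = dirac_sum {1..n} (\<lambda>i. (1 / real n) * of_int (max 0 (c i))) y"
proof -
  have "pos_part \<kappa> = dirac_sum {1..n} (\<lambda>i. max 0 ((1 / real n) * of_int (c i))) y"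
  proof (rule pos_part_dirac_sum)
    fix i j assume ij: "i \<in> {1..n}" "j \<in> {1..n}" "0 < 1 / real n * of_int (c i)" "1 / real n * of_int (c j) < 0"
    then have "c i = 1" "c j = -1" using range[of i] range[of j] by auto
    then show "y i \<noteq> y j" using sep[of i j] ij by simp
  qed (use c in auto)
  also have "\<dots> = dirac_sum {1..n} (\<lambda>i. (1 / real n) * of_int (max 0 (c i))) y"
    by (rule dirac_sum_cong) (use range in force)+
  finally show ?thesis .
qed

section \<open>Wasserstein distance of empirical measures\<close>

lemma sets_charged_line [measurable_cong]: "sets charged_line = sets (borel \<Otimes>\<^sub>M count_space {-1, 1})"
  by (simp add: charged_line_def)

lemma space_charged_line: "space charged_line = UNIV \<times> {-1, 1}"
  by (simp add: charged_line_def space_pair_measure)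

lemma measurable_charged_line [measurable]:
  assumes "\<And>i. i \<in> I \<Longrightarrow> q i \<in> {-1, 1}"
  shows "(\<lambda>i. (y i, q i)) \<in> point_measure I w \<rightarrow>\<^sub>M charged_line"
  using assms by (auto simp: space_charged_line)

text \<open>As a push-forward of the weighted index set, the measure admits couplings built from
  maps on indices, and coinciding particles need no special treatment.\<close>

lemma glue_empirical:
  assumes b0: "\<And>i. i \<in> {1..n} \<Longrightarrow> b0 i \<in> {-1, 1}"
  shows "glue (empirical n b0 y) =
    distr (point_measure {1..n} (\<lambda>_. ennreal (1 / real n))) charged_line (\<lambda>i. (y i, b0 i))" (is "_ = ?G")
proof -
  have eq: "emeasure (fst (empirical n b0 y)) {x. (x, 1) \<in> A} + emeasure (snd (empirical n b0 y)) {x. (x, -1) \<in> A}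
      = emeasure ?G A" if A: "A \<in> sets charged_line" for A
  proof -
    have A': "A \<in> sets (borel \<Otimes>\<^sub>M count_space {-1, 1 :: int})" using A by (simp add: sets_charged_line)
    have [measurable]: "{x. (x, p) \<in> A} \<in> sets borel" for p
      using sets_Pair2[OF A', of p] by (simp add: vimage_def)
    have "emeasure ?G A = (\<Sum>i=1..n. ennreal (1 / real n) * indicator A (y i, b0 i))"
      using b0 A
      by (subst nn_integral_indicator[symmetric], simp, subst nn_integral_distr)
        (auto simp: nn_integral_point_measure_finite space_charged_line)
    also have "\<dots> = (\<Sum>i=1..n. ennreal (1 / real n) * indicator {x. (x, 1) \<in> A} (y i) * of_bool (b0 i = 1) +
        ennreal (1 / real n) * indicator {x. (x, -1) \<in> A} (y i) * of_bool (b0 i = -1))"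
    proof (rule sum.cong[OF refl])
      fix i assume "i \<in> {1..n}"
      from b0[OF this] show "ennreal (1 / real n) * indicator A (y i, b0 i) =
        ennreal (1 / real n) * indicator {x. (x, 1) \<in> A} (y i) * of_bool (b0 i = 1) +
        ennreal (1 / real n) * indicator {x. (x, -1) \<in> A} (y i) * of_bool (b0 i = -1)"
        by (auto simp: indicator_def)
    qed
    also have "\<dots> = emeasure (fst (empirical n b0 y)) {x. (x, 1) \<in> A}
        + emeasure (snd (empirical n b0 y)) {x. (x, -1) \<in> A}"
      unfolding sum.distrib empirical_def
      by (auto simp: emeasure_dirac_sum intro!: arg_cong2[where f = "(+)"] sum.mono_neutral_cong_right)
    finally show ?thesis by simp
  qed
  have "glue (empirical n b0 y) = measure_of (space charged_line) (sets charged_line) (emeasure ?G)"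
    unfolding glue_def
    by (rule measure_of_eq) (use eq sets.space_closed[of charged_line] in \<open>simp_all only: sets.sigma_sets_eq\<close>)
  also have "\<dots> = ?G"
    using measure_of_of_measure[of ?G] by simp
  finally show ?thesis .
qed

lemma borel_measurable_cost [measurable]:
  "cost \<in> borel_measurable (charged_line \<Otimes>\<^sub>M charged_line)"
proof -
  have [measurable]: "fst \<in> borel_measurable charged_line"
    unfolding charged_line_def by measurable
  have [measurable]: "(\<lambda>p. real_of_int (snd p)) \<in> borel_measurable charged_line"
    unfolding charged_line_def by (rule measurable_compose[OF measurable_snd]) simp
  have "cost = (\<lambda>p. \<bar>fst (fst p) - fst (snd p)\<bar>\<^sup>2 + \<bar>real_of_int (snd (fst p)) - real_of_int (snd (snd p))\<bar>)"
    by (auto simp: cost_def)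
  also have "\<dots> \<in> borel_measurable (charged_line \<Otimes>\<^sub>M charged_line)"
    by measurable
  finally show ?thesis .
qed

lemma transport_cost_empirical_le:
  assumes b0: "\<And>i. i \<in> {1..n} \<Longrightarrow> b0 i \<in> {-1, 1}"
  shows "(INF \<gamma>\<in>couplings (empirical n b0 y) (empirical n b0 z). \<integral>\<^sup>+ p. ennreal (cost p) \<partial>\<gamma>)
    \<le> ennreal (1 / real n * (\<Sum>i=1..n. (y i - z i)\<^sup>2))"
proof (rule INF_lower2)
  let ?P = "point_measure {1..n} (\<lambda>_. ennreal (1 / real n))"
  \<comment> \<open>Particle \<open>i\<close> is sent to itself, so the charge term of
    \<open>cost\<close> is zero and only squared displacements remain.\<close>
  let ?g = "\<lambda>i. ((y i, b0 i), (z i, b0 i))"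
  let ?\<gamma> = "distr ?P (charged_line \<Otimes>\<^sub>M charged_line) ?g"
  have glue_y: "glue (empirical n b0 y) = distr ?P charged_line (\<lambda>i. (y i, b0 i))"
    and glue_z: "glue (empirical n b0 z) = distr ?P charged_line (\<lambda>i. (z i, b0 i))"
    by (rule glue_empirical, erule b0)+
  have g: "?g \<in> ?P \<rightarrow>\<^sub>M charged_line \<Otimes>\<^sub>M charged_line"
    using b0 by (auto simp: space_pair_measure space_charged_line)
  show "?\<gamma> \<in> couplings (empirical n b0 y) (empirical n b0 z)"
    using g unfolding couplings_def glue_y glue_z by (simp add: distr_distr o_def)
  have "(\<integral>\<^sup>+ p. ennreal (cost p) \<partial>?\<gamma>) = (\<Sum>i=1..n. ennreal (1 / real n) * ennreal ((y i - z i)\<^sup>2))"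
    by (subst nn_integral_distr[OF g], measurable) (simp add: nn_integral_point_measure_finite cost_def)
  also have "\<dots> = ennreal (1 / real n * (\<Sum>i=1..n. (y i - z i)\<^sup>2))"
    by (simp add: sum_distrib_left ennreal_mult' sum_ennreal flip: ennreal_mult)
  finally show "(\<integral>\<^sup>+ p. ennreal (cost p) \<partial>?\<gamma>) \<le> ennreal (1 / real n * (\<Sum>i=1..n. (y i - z i)\<^sup>2))"
    by simp
qed

text \<open>The second marginal of a coupling lives on finitely many atoms, so its cost is at least the squared
  distance to the nearest atom, integrated against the first marginal.\<close>

lemma transport_cost_empirical_ge:
  assumes b0: "\<And>i. i \<in> {1..n} \<Longrightarrow> b0 i \<in> {-1, 1}"
    and near: "\<And>i j. i \<in> {1..n} \<Longrightarrow> j \<in> {1..n} \<Longrightarrow> (y i - z i)\<^sup>2 \<le> cost ((y i, b0 i), (z j, b0 j))"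
  shows "ennreal (1 / real n * (\<Sum>i=1..n. (y i - z i)\<^sup>2)) \<le>
    (INF \<gamma>\<in>couplings (empirical n b0 y) (empirical n b0 z). \<integral>\<^sup>+ p. ennreal (cost p) \<partial>\<gamma>)"
proof (rule INF_greatest)
  fix \<gamma> assume "\<gamma> \<in> couplings (empirical n b0 y) (empirical n b0 z)"
  let ?P = "point_measure {1..n} (\<lambda>_. ennreal (1 / real n))"
  let ?S = "(\<lambda>i. (z i, b0 i)) ` {1..n}"
  have glue_y: "glue (empirical n b0 y) = distr ?P charged_line (\<lambda>i. (y i, b0 i))"
    and glue_z: "glue (empirical n b0 z) = distr ?P charged_line (\<lambda>i. (z i, b0 i))"
    by (rule glue_empirical, erule b0)+
  from \<open>\<gamma> \<in> _\<close> have sets_\<gamma> [measurable_cong]: "sets \<gamma> = sets (charged_line \<Otimes>\<^sub>M charged_line)"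
    and fst_\<gamma>: "distr \<gamma> charged_line fst = distr ?P charged_line (\<lambda>i. (y i, b0 i))"
    and snd_\<gamma>: "distr \<gamma> charged_line snd = distr ?P charged_line (\<lambda>i. (z i, b0 i))"
    unfolding couplings_def glue_y glue_z by simp_all
  have fst_meas: "fst \<in> \<gamma> \<rightarrow>\<^sub>M charged_line" and snd_meas: "snd \<in> \<gamma> \<rightarrow>\<^sub>M charged_line"
    by (simp_all cong: measurable_cong_sets add: measurable_cong_sets[OF sets_\<gamma> refl])
  have S_single: "{(z i, b0 i)} \<in> sets charged_line" if "i \<in> {1..n}" for i
    using pair_measureI[of "{z i}" borel "{b0 i}" "count_space {-1, 1}"] b0[OF that]
    by (auto simp: sets_charged_line)
  have S: "?S \<in> sets charged_line"
  proof -
    have "(\<Union>i\<in>{1..n}. {(z i, b0 i)}) \<in> sets charged_line"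
      by (intro sets.finite_UN) (use S_single in auto)
    then show ?thesis by (simp add: UNION_singleton_eq_range)
  qed
  have meas_y: "(\<lambda>i. (y i, b0 i)) \<in> ?P \<rightarrow>\<^sub>M charged_line"
    and meas_z: "(\<lambda>i. (z i, b0 i)) \<in> ?P \<rightarrow>\<^sub>M charged_line"
    by (rule measurable_charged_line, erule b0)+
  \<comment> \<open>\<open>h p\<close> is the cheapest cost from \<open>p\<close> to an atom of the
    second measure. By \<open>near\<close> it is at least \<open>(y i - z i)\<^sup>2\<close> at the
    \<open>i\<close>th atom of the first.\<close>
  define h where "h = (\<lambda>p. INF q\<in>?S. ennreal (cost (p, q)))"
  have h_meas: "h \<in> borel_measurable charged_line"
    unfolding h_def
  proof (rule borel_measurable_INF)
    fix q assume "q \<in> ?S"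
    then have "q \<in> space charged_line" using b0 unfolding space_charged_line by blast
    then show "(\<lambda>p. ennreal (cost (p, q))) \<in> borel_measurable charged_line" by measurable
  qed simp
  \<comment> \<open>The second marginal is carried by \<open>?S\<close>, so almost every
    \<open>p\<close> has \<open>snd p\<close> among the atoms, and there \<open>h (fst p)\<close>
    bounds \<open>cost p\<close> from below.\<close>
  have "AE q in distr \<gamma> charged_line snd. q \<in> ?S"
    unfolding snd_\<gamma> using S by (subst AE_distr_iff[OF meas_z]) (auto simp: AE_point_measure)
  then have AE_S: "AE p in \<gamma>. snd p \<in> ?S"
    using S by (subst (asm) AE_distr_iff[OF snd_meas]) auto
  have "ennreal (1 / real n * (\<Sum>i=1..n. (y i - z i)\<^sup>2)) =
      (\<Sum>i=1..n. ennreal (1 / real n) * ennreal ((y i - z i)\<^sup>2))"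
    by (simp add: sum_distrib_left ennreal_mult' sum_ennreal flip: ennreal_mult)
  also have "\<dots> \<le> (\<Sum>i=1..n. ennreal (1 / real n) * h (y i, b0 i))"
    unfolding h_def using near by (intro sum_mono mult_left_mono INF_greatest) (auto intro!: ennreal_leI)
  also have "\<dots> = (\<integral>\<^sup>+ p. h p \<partial>distr ?P charged_line (\<lambda>i. (y i, b0 i)))"
    using h_meas by (subst nn_integral_distr[OF meas_y]) (auto simp: nn_integral_point_measure_finite)
  also have "\<dots> = (\<integral>\<^sup>+ p. h (fst p) \<partial>\<gamma>)"
    unfolding fst_\<gamma>[symmetric] using h_meas by (subst nn_integral_distr[OF fst_meas]) auto
  also have "\<dots> \<le> (\<integral>\<^sup>+ p. ennreal (cost p) \<partial>\<gamma>)"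
  proof (rule nn_integral_mono_AE)
    show "AE p in \<gamma>. h (fst p) \<le> ennreal (cost p)"
      using AE_S unfolding h_def by eventually_elim (auto intro!: INF_lower2)
  qed
  finally show "ennreal (1 / real n * (\<Sum>i=1..n. (y i - z i)\<^sup>2)) \<le> (\<integral>\<^sup>+ p. ennreal (cost p) \<partial>\<gamma>)" .
qed

lemma wasserstein_empirical_le:
  assumes "\<And>i. i \<in> {1..n} \<Longrightarrow> b0 i \<in> {-1, 1}"
  shows "wasserstein (empirical n b0 y) (empirical n b0 z) \<le> sqrt (1 / real n * (\<Sum>i=1..n. (y i - z i)\<^sup>2))"
proof -
  have "enn2real (INF \<gamma>\<in>couplings (empirical n b0 y) (empirical n b0 z). \<integral>\<^sup>+ p. ennreal (cost p) \<partial>\<gamma>)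
      \<le> 1 / real n * (\<Sum>i=1..n. (y i - z i)\<^sup>2)"
    using transport_cost_empirical_le[OF assms] by (intro enn2real_leI) (auto simp: sum_nonneg)
  then show ?thesis by (simp add: wasserstein_def)
qed

lemma wasserstein_empirical_eq:
  assumes "\<And>i. i \<in> {1..n} \<Longrightarrow> b0 i \<in> {-1, 1}"
    and "\<And>i j. i \<in> {1..n} \<Longrightarrow> j \<in> {1..n} \<Longrightarrow> (y i - z i)\<^sup>2 \<le> cost ((y i, b0 i), (z j, b0 j))"
  shows "wasserstein (empirical n b0 y) (empirical n b0 z) = sqrt (1 / real n * (\<Sum>i=1..n. (y i - z i)\<^sup>2))"
proof -
  have "(INF \<gamma>\<in>couplings (empirical n b0 y) (empirical n b0 z). \<integral>\<^sup>+ p. ennreal (cost p) \<partial>\<gamma>)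
      = ennreal (1 / real n * (\<Sum>i=1..n. (y i - z i)\<^sup>2))"
    using transport_cost_empirical_le[OF assms(1)] transport_cost_empirical_ge[OF assms]
    by (intro antisym)
  then show ?thesis by (simp add: wasserstein_def sum_nonneg)
qed

text \<open>Particles may coincide at \<open>t\<close>, whatever their charges, since only positive
  gaps enter \<delta>. Near \<open>t\<close> the metric quotient is exactly a root mean square of
  difference quotients, and these converge.\<close>

lemma metric_derivative_empirical:
  assumes b0: "\<And>i. i \<in> {1..n} \<Longrightarrow> b0 i \<in> {-1, 1}"
    and der: "\<And>i. i \<in> {1..n} \<Longrightarrow> ((\<lambda>s. x s i) has_real_derivative v i) (at t)"
  shows "has_metric_derivative (\<lambda>s. empirical n b0 (x s)) (sqrt (1 / real n * (\<Sum>i=1..n. (v i)\<^sup>2))) t"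
proof -
  define gaps where "gaps = (\<lambda>(i, j). \<bar>x t i - x t j\<bar>) ` ({1..n} \<times> {1..n}) - {0}"
  \<comment> \<open>Including 1 keeps the minimum defined when all positions agree, and keeps
    displacements cheaper than a change of charge.\<close>
  define \<delta> where "\<delta> = Min (insert 1 gaps)"
  have fin: "finite (insert 1 gaps)" unfolding gaps_def by simp
  have "\<delta> > 0" unfolding \<delta>_def using fin by (subst Min_gr_iff) (auto simp: gaps_def)
  have "\<delta> \<le> 1" unfolding \<delta>_def by (rule Min_le) (use fin in auto)
  have gap: "\<delta> \<le> \<bar>x t i - x t j\<bar>" if "i \<in> {1..n}" "j \<in> {1..n}" "x t i \<noteq> x t j" for i j
    unfolding \<delta>_def by (rule Min_le) (use fin that in \<open>auto simp: gaps_def\<close>)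
  have "\<forall>\<^sub>F s in at t. \<bar>x s i - x t i\<bar> < \<delta> / 2" if "i \<in> {1..n}" for i
  proof -
    have "((\<lambda>s. x s i) \<longlongrightarrow> x t i) (at t)"
      using DERIV_isCont[OF der[OF that]] by (simp add: isCont_def)
    from tendstoD[OF this, of "\<delta> / 2"] show ?thesis using \<open>\<delta> > 0\<close> by (simp add: dist_real_def)
  qed
  then have "\<forall>\<^sub>F s in at t. \<forall>i\<in>{1..n}. \<bar>x s i - x t i\<bar> < \<delta> / 2"
    by (intro eventually_ball_finite) auto
  then have "\<forall>\<^sub>F s in at t. wasserstein (empirical n b0 (x s)) (empirical n b0 (x t)) / \<bar>s - t\<bar> =
      sqrt (1 / real n * (\<Sum>i=1..n. ((x s i - x t i) / (s - t))\<^sup>2))"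
  proof eventually_elim
    case (elim s)
    have "(x s i - x t i)\<^sup>2 \<le> cost ((x s i, b0 i), (x t j, b0 j))" if ij: "i \<in> {1..n}" "j \<in> {1..n}" for i j
    proof -
      have *: "\<bar>x s i - x t i\<bar> < \<delta> / 2" using elim ij by auto
      show ?thesis
      proof (cases "b0 i = b0 j")
        case True
        \<comment> \<open>If the positions at \<open>t\<close> differ, they are at least \<delta>
          apart, so after a move by less than \<delta>/2 particle \<open>i\<close> is still closer
          to \<open>x t i\<close>; if they agree, the distances are equal.\<close>
        have "\<bar>x s i - x t i\<bar> \<le> \<bar>x s i - x t j\<bar>"
          using * gap[OF ij] by (cases "x t i = x t j") linarith+
        then show ?thesis
          using True by (simp add: cost_def abs_le_square_iff)
      next
        case False
        \<comment> \<open>A change of charge costs at least 1, which dominates the square of a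
          displacement below \<delta>/2.\<close>
        then have "\<bar>b0 i - b0 j\<bar> \<ge> 1" by simp
        then have "(1::real) \<le> of_int \<bar>b0 i - b0 j\<bar>" by linarith
        moreover have "(x s i - x t i)\<^sup>2 \<le> 1"
          using * \<open>\<delta> \<le> 1\<close> by (intro abs_square_le_1[THEN iffD2]) auto
        moreover have "0 \<le> \<bar>x s i - x t j\<bar>\<^sup>2" by simp
        ultimately show ?thesis unfolding cost_def prod.case by linarith
      qed
    qed
    then have "wasserstein (empirical n b0 (x s)) (empirical n b0 (x t)) =
        sqrt (1 / real n * (\<Sum>i=1..n. (x s i - x t i)\<^sup>2))"
      using b0 by (intro wasserstein_empirical_eq) auto
    then have "wasserstein (empirical n b0 (x s)) (empirical n b0 (x t)) / \<bar>s - t\<bar> =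
        sqrt (1 / real n * (\<Sum>i=1..n. (x s i - x t i)\<^sup>2) / (s - t)\<^sup>2)"
      by (simp only: real_sqrt_divide real_sqrt_abs)
    also have "1 / real n * (\<Sum>i=1..n. (x s i - x t i)\<^sup>2) / (s - t)\<^sup>2 =
        1 / real n * (\<Sum>i=1..n. ((x s i - x t i) / (s - t))\<^sup>2)"
      by (simp add: sum_divide_distrib power_divide mult.commute)
    finally show ?case .
  qed
  moreover have "((\<lambda>s. sqrt (1 / real n * (\<Sum>i=1..n. ((x s i - x t i) / (s - t))\<^sup>2)))
      \<longlongrightarrow> sqrt (1 / real n * (\<Sum>i=1..n. (v i)\<^sup>2))) (at t)"
    using der by (intro tendsto_intros) (simp add: has_field_derivative_iff)
  ultimately show ?thesis
    unfolding has_metric_derivative_def by (simp add: tendsto_cong)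
qed

lemma empirical_in_P2m:
  assumes "\<And>i. i \<in> {1..n} \<Longrightarrow> b0 i \<in> {-1, 1}" "n > 0"
  shows "empirical n b0 y \<in> P2m (real (card {i \<in> {1..n}. b0 i = 1}) / real n)"
proof -
  let ?P = "{i \<in> {1..n}. b0 i = 1}" and ?N = "{i \<in> {1..n}. b0 i = -1}"
  have "b0 i = 1 \<or> b0 i = -1" if "i \<in> {1..n}" for i
    using assms(1)[OF that] by auto
  then have "?P \<union> ?N = {1..n}" by blast
  moreover have "?P \<inter> ?N = {}" by auto
  ultimately have "card ?P + card ?N = n"
    using card_Un_disjoint[of ?P ?N] by simp
  then have "real (card ?P) + real (card ?N) = real n" by (simp flip: of_nat_add)
  then have "ennreal (real (card ?P) / real n) + ennreal (real (card ?N) / real n) = 1"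
    using assms by (simp flip: ennreal_plus add_divide_distrib)
  moreover have "of_nat c * ennreal (1 / real n) = ennreal (real c / real n)" for c
    by (simp add: ennreal_of_nat_eq_real_of_nat flip: ennreal_mult')
  ultimately have "emeasure (fst (empirical n b0 y)) UNIV + emeasure (snd (empirical n b0 y)) UNIV = 1"
    by (simp add: empirical_def emeasure_dirac_sum)
  moreover have "(\<integral>\<^sup>+ x. ennreal (x\<^sup>2) \<partial>dirac_sum I w y) < \<infinity>" if "finite I" for I w
    using that by (simp add: nn_integral_dirac_sum ennreal_mult_less_top)
  ultimately show ?thesis
    by (auto simp: P2m_def P2_def empirical_def measure_dirac_sum)
qed

section \<open>The weak equation\<close>

text \<open>The C1 hypothesis supplies a continuous derivative \<open>D\<close>, which agrees with
  \<open>dV V\<close> off 0. Oddness comes from differentiating the evenness of \<open>V\<close> in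
  a neighbourhood of \<open>r\<close> avoiding 0; at \<open>r = 0\<close> it is the convention
  \<open>dV V 0 = 0\<close>.\<close>

lemma
  assumes "admissible_potentials V W"
  shows continuous_dV: "continuous_on (- {0}) (dV V)"
    and dV_minus: "dV V (- r) = - dV V r"
proof -
  from assms obtain D where D: "\<And>r. r \<noteq> 0 \<Longrightarrow> (V has_real_derivative D r) (at r)"
    and cont: "continuous_on (- {0}) D"
    unfolding admissible_potentials_def C1_differentiable_on_def has_real_derivative_iff_has_vector_derivative
    by auto
  have dV: "dV V r = D r" if "r \<noteq> 0" for r
    using D[OF that] that by (simp add: dV_def DERIV_imp_deriv)
  show "continuous_on (- {0}) (dV V)"
    using cont by (rule continuous_on_eq) (simp add: dV)
  show "dV V (- r) = - dV V r"
  proof (cases "r = 0")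
    case False
    have "((\<lambda>u. V (- u)) has_real_derivative - D (- r)) (at r)"
      using D[of "- r"] False by (simp add: DERIV_mirror[symmetric])
    moreover have "\<forall>\<^sub>F u in nhds r. V (- u) = V u"
      using assms False
      by (intro eventually_mono[OF t1_space_nhds[of r 0]]) (auto simp: admissible_potentials_def)
    ultimately have "(V has_real_derivative - D (- r)) (at r)"
      by (subst (asm) DERIV_cong_ev) auto
    then have "D r = - D (- r)" using D[OF False] DERIV_unique by blast
    then show ?thesis using False by (simp add: dV)
  qed (simp add: dV_def)
qed

lemma continuous_deriv_W:
  assumes "admissible_potentials V W"
  shows "continuous_on UNIV (deriv W)"
  using assms unfolding admissible_potentials_def by (auto intro: lipschitz_on_continuous_on)

lemma borel_measurable_dV:
  assumes "admissible_potentials V W"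
  shows "dV V \<in> borel_measurable borel"
  using borel_measurable_continuous_countable_exceptions[of "{0}" "dV V"] continuous_dV[OF assms] by simp

text \<open>The hypothesis holds only almost everywhere. By continuity off 0 the set where the bound
  fails is open, and an open null set is empty.\<close>

lemma dV_bound:
  assumes "admissible_potentials V W"
  obtains C where "\<And>r. \<bar>r * dV V r\<bar> \<le> C"
proof -
  from assms obtain C where C: "AE r in lborel. \<bar>r * dV V r\<bar> \<le> C"
    unfolding admissible_potentials_def essentially_bounded_def by blast
  \<comment> \<open>Taking \<open>max C 0\<close> lets the same bound cover \<open>r = 0\<close>,
    where the product is 0.\<close>
  let ?N = "- {0} \<inter> (\<lambda>r. \<bar>r * dV V r\<bar>) -` {max C 0<..}"
  have "continuous_on (- {0}) (\<lambda>r. \<bar>r * dV V r\<bar>)"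
    by (intro continuous_intros continuous_dV[OF assms])
  then have "open ?N"
    by (rule continuous_open_preimage) auto
  have "AE r in lborel. r \<notin> ?N"
    using C by eventually_elim auto
  then have "?N \<in> null_sets lborel"
    using AE_iff_null_sets[of ?N lborel] borel_open[OF \<open>open ?N\<close>] by simp
  then have "negligible ?N"
    using null_sets_completionI[of ?N lborel] by (simp add: negligible_iff_null_sets)
  then have "?N = {}"
    using open_not_negligible[OF \<open>open ?N\<close>] by blast
  then have "\<bar>r * dV V r\<bar> \<le> max C 0" for r
    by (cases "r = 0") (auto simp: set_eq_iff not_less)
  then show thesis by (rule that)
qed

text \<open>The second \<open>x\<close>-derivative will control increments of
  \<open>dx \<phi>\<close> against the singularity of \<open>dV V\<close>. Vanishing at the end
  times, due to compact support in the open time interval, removes the boundary terms.\<close>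

lemma test_function_derivatives:
  assumes "\<phi> \<in> test_functions T"
  shows "continuous_on UNIV (\<lambda>(t, x). \<phi> t x)" "continuous_on UNIV (\<lambda>(t, x). dt \<phi> t x)"
    "continuous_on UNIV (\<lambda>(t, x). dx \<phi> t x)" "continuous_on UNIV (\<lambda>(t, x). dx (dx \<phi>) t x)"
    "((\<lambda>s. \<phi> s x) has_real_derivative dt \<phi> t x) (at t)"
    "((\<lambda>y. \<phi> t y) has_real_derivative dx \<phi> t x) (at x)"
    "((\<lambda>y. dx \<phi> t y) has_real_derivative dx (dx \<phi>) t x) (at x)"
    "\<phi> 0 x = 0" "\<phi> T x = 0"
proof -
  have "Ck (Suc (Suc (Suc 0))) \<phi>" and "Ck 0 \<phi>" using assms unfolding test_functions_def by blast+
  then have *: "(\<lambda>s. \<phi> s x) differentiable (at t)" "(\<lambda>y. \<phi> t y) differentiable (at x)"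
    "(\<lambda>y. dx \<phi> t y) differentiable (at x)"
    and "continuous_on UNIV (\<lambda>(t, x). \<phi> t x)" "continuous_on UNIV (\<lambda>(t, x). dt \<phi> t x)"
    "continuous_on UNIV (\<lambda>(t, x). dx \<phi> t x)" "continuous_on UNIV (\<lambda>(t, x). dx (dx \<phi>) t x)"
    by simp_all
  then show "continuous_on UNIV (\<lambda>(t, x). \<phi> t x)" "continuous_on UNIV (\<lambda>(t, x). dt \<phi> t x)"
    "continuous_on UNIV (\<lambda>(t, x). dx \<phi> t x)" "continuous_on UNIV (\<lambda>(t, x). dx (dx \<phi>) t x)"
    by simp_all
  show "((\<lambda>s. \<phi> s x) has_real_derivative dt \<phi> t x) (at t)"
    "((\<lambda>y. \<phi> t y) has_real_derivative dx \<phi> t x) (at x)"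
    "((\<lambda>y. dx \<phi> t y) has_real_derivative dx (dx \<phi>) t x) (at x)"
    using * by (simp_all add: dt_def[of \<phi>] dx_def[of \<phi>] dx_def[of "dx \<phi>"] DERIV_deriv_iff_real_differentiable)
  show "\<phi> 0 x = 0" "\<phi> T x = 0"
    using assms unfolding test_functions_def by force+
qed

text \<open>\<open>Ck\<close> provides partial derivatives only. Continuity of
  \<open>dx \<phi>\<close> makes them a total derivative, which is then composed with the curve
  \<open>\<lambda>s. (s, X s)\<close>.\<close>

lemma test_function_chain_rule:
  assumes \<phi>: "\<phi> \<in> test_functions T" and X: "(X has_real_derivative v) (at t)"
  shows "((\<lambda>s. \<phi> s (X s)) has_real_derivative dt \<phi> t (X t) + dx \<phi> t (X t) * v) (at t)"
proof -
  have "((\<lambda>(s, y). \<phi> s y) has_derivative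
      (\<lambda>(ts, ty). dt \<phi> t (X t) * ts + blinfun_apply (blinfun_mult_right (dx \<phi> t (X t))) ty))
      (at (t, X t) within UNIV \<times> UNIV)"
  proof (rule has_derivative_partialsI)
    show "((\<lambda>s. \<phi> s (X t)) has_derivative (\<lambda>ts. dt \<phi> t (X t) * ts)) (at t)"
      using test_function_derivatives(5)[OF \<phi>] by (simp add: has_field_derivative_def)
    show "((\<lambda>y. \<phi> s y) has_derivative blinfun_apply (blinfun_mult_right (dx \<phi> s y))) (at y)" for s y
      using test_function_derivatives(6)[OF \<phi>] by (simp add: has_field_derivative_def)
    show "continuous (at (t, X t) within UNIV \<times> UNIV) (\<lambda>(s, y). blinfun_mult_right (dx \<phi> s y))"
      using test_function_derivatives(3)[OF \<phi>]
      by (auto simp: case_prod_unfold continuous_on_eq_continuous_within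
          intro!: bounded_linear.continuous[OF bounded_linear_blinfun_mult_right])
  qed auto
  then have "((\<lambda>(s, y). \<phi> s y) has_derivative (\<lambda>(ts, ty). dt \<phi> t (X t) * ts + dx \<phi> t (X t) * ty)) (at (t, X t))"
    by simp
  moreover have "((\<lambda>s. (s, X s)) has_derivative (\<lambda>h. (h, v * h))) (at t)"
    using X by (auto simp: has_field_derivative_def intro!: derivative_eq_intros)
  ultimately have "((\<lambda>s. case (s, X s) of (s, y) \<Rightarrow> \<phi> s y) has_derivative
      (\<lambda>h. case (h, v * h) of (ts, ty) \<Rightarrow> dt \<phi> t (X t) * ts + dx \<phi> t (X t) * ty)) (at t)"
    by (rule has_derivative_compose[rotated])
  moreover have "(\<lambda>h. case (h, v * h) of (ts, ty) \<Rightarrow> dt \<phi> t (X t) * ts + dx \<phi> t (X t) * ty) =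
      (*) (dt \<phi> t (X t) + dx \<phi> t (X t) * v)"
    by (auto simp: fun_eq_iff algebra_simps)
  ultimately show ?thesis
    by (simp add: has_field_derivative_def)
qed

text \<open>Measurability is asked on the restricted space because the trajectories are controlled
  only inside \<open>{0..T}\<close>; that space has finite measure, so bounded functions are
  integrable.\<close>

lemma set_integrable_bounded:
  fixes f :: "real \<Rightarrow> real"
  assumes f: "f \<in> borel_measurable (restrict_space lborel {a<..<b})"
    and bound: "\<And>t. t \<in> {a<..<b} \<Longrightarrow> \<bar>f t\<bar> \<le> M"
  shows "set_integrable lborel {a<..<b} f"
proof -
  interpret finite_measure "restrict_space lborel {a<..<b}"
    using emeasure_bounded_finite[of "{a<..<b}"]
    by (intro finite_measureI) (auto simp: emeasure_restrict_space space_restrict_space)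
  have "integrable (restrict_space lborel {a<..<b}) f"
    by (rule integrable_const_bound[of _ M]) (use assms in \<open>auto intro!: AE_I2 simp: space_restrict_space\<close>)
  then show ?thesis
    by (subst (asm) integrable_restrict_space) (simp_all add: set_integrable_def)
qed

lemma set_integrable_sum:
  fixes f :: "'i \<Rightarrow> 'a \<Rightarrow> real"
  assumes "\<And>i. i \<in> I \<Longrightarrow> set_integrable M A (f i)"
  shows "set_integrable M A (\<lambda>t. \<Sum>i\<in>I. f i t)"
proof -
  have "integrable M (\<lambda>t. \<Sum>i\<in>I. indicator A t *\<^sub>R f i t)"
    using assms by (intro Bochner_Integration.integrable_sum) (simp add: set_integrable_def)
  then show ?thesis by (simp add: set_integrable_def sum_distrib_left)
qed

text \<open>The parameter \<open>p\<close> treats both equations at once. The density \<rho> keeps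
  every particle that started with charge \<open>p\<close>, even after annihilation, while \<eta>
  and \<zeta> give weight only to those still charged.\<close>

lemma weak_equation_particles:
  fixes p :: int
  assumes adm: "admissible_potentials V W" and T: "T > 0" and p: "p \<in> {-1, 1}"
    and b0: "\<And>i. i \<in> {1..n} \<Longrightarrow> b0 i \<in> {-1, 1}"
    and b: "\<And>t i. t \<in> {0<..<T} \<Longrightarrow> i \<in> {1..n} \<Longrightarrow> b t i = b0 i * of_bool (ereal t < tau i)"
    and cont: "\<And>i. i \<in> {1..n} \<Longrightarrow> continuous_on {0..T} (\<lambda>t. x t i)"
    and S: "finite S"
    and der: "\<And>s i. s \<in> {0<..<T} - S \<Longrightarrow> i \<in> {1..n} \<Longrightarrow>
       ((\<lambda>r. x r i) has_real_derivative
          - (1 / real n) * (\<Sum>j | j \<in> {1..n} \<and> b s i * b s j = 1. dV V (x s i - x s j))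
          - (1 / real n) * (\<Sum>j | j \<in> {1..n} \<and> b s i * b s j = -1. deriv W (x s i - x s j))) (at s)"
    and \<rho>: "\<And>t. t \<in> {0<..<T} \<Longrightarrow> \<rho> t = dirac_sum {i \<in> {1..n}. b0 i = p} (\<lambda>_. 1 / real n) (x t)"
    and \<eta>: "\<And>t. t \<in> {0<..<T} \<Longrightarrow>
      \<eta> t = dirac_sum {1..n} (\<lambda>i. (1 / real n) * of_int (max 0 (p * b t i))) (x t)"
    and \<zeta>: "\<And>t. t \<in> {0<..<T} \<Longrightarrow>
      \<zeta> t = dirac_sum {1..n} (\<lambda>i. (1 / real n) * of_int (max 0 (- p * b t i))) (x t)"
  shows "weak_equation V W T \<rho> \<eta> \<zeta>"
  unfolding weak_equation_def
proof
  fix \<phi> assume \<phi>: "\<phi> \<in> test_functions T"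
  note \<phi>_facts = test_function_derivatives[OF \<phi>]
  \<comment> \<open>\<open>A i\<close> and \<open>B i\<close> indicate that particle
    \<open>i\<close> still carries charge \<open>p\<close> or \<open>- p\<close>. As real factors
    they let the interaction sums run over a fixed index set.\<close>
  define A where "A = (\<lambda>i t. of_bool (b0 i = p \<and> ereal t < tau i) :: real)"
  define B where "B = (\<lambda>i t. of_bool (b0 i = - p \<and> ereal t < tau i) :: real)"
  let ?c = "1 / real n"
  let ?M = "restrict_space lborel {0<..<T}"
  have b_cases: "b0 i = p \<or> b0 i = - p" if "i \<in> {1..n}" for i
    using b0[OF that] p by auto
  have pp: "p * p = 1" "p \<noteq> - p" using p by auto
  have A_eq: "of_int (max 0 (p * b t i)) = A i t" and B_eq: "of_int (max 0 (- p * b t i)) = B i t"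
    if "t \<in> {0<..<T}" "i \<in> {1..n}" for t i
    using b[OF that] b_cases[OF that(2)] pp p by (auto simp: A_def B_def)

  \<comment> \<open>The three integrands as finite sums over particles\<close>
  define f where "f = (\<lambda>t. \<Sum>i | i \<in> {1..n} \<and> b0 i = p. ?c * dt \<phi> t (x t i))"
  define g where "g = (\<lambda>t. \<Sum>i=1..n. \<Sum>j=1..n. (?c * A i t) * (?c * A j t) *
      ((dx \<phi> t (x t i) - dx \<phi> t (x t j)) * dV V (x t i - x t j)))"
  define h where "h = (\<lambda>t. \<Sum>i=1..n. \<Sum>j=1..n. (?c * A i t) * (?c * B j t) *
      (dx \<phi> t (x t i) * deriv W (x t i - x t j)))"

  have slice: "continuous_on UNIV (F t)" if "continuous_on UNIV (\<lambda>(t, x). F t x)" for F :: "real \<Rightarrow> real \<Rightarrow> real" and t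
  proof -
    have "continuous_on UNIV (\<lambda>x::real. (t, x))" by (intro continuous_intros)
    from continuous_on_compose2[OF that this] show ?thesis by simp
  qed
  have dx_meas [measurable]: "dx \<phi> t \<in> borel_measurable borel" and dt_meas [measurable]: "dt \<phi> t \<in> borel_measurable borel" for t
    using slice[OF \<phi>_facts(3)] slice[OF \<phi>_facts(2)] by (auto intro: borel_measurable_continuous_onI)
  have [measurable]: "dV V \<in> borel_measurable borel" by (rule borel_measurable_dV[OF adm])
  have W_cont: "continuous_on UNIV (deriv W)" by (rule continuous_deriv_W[OF adm])
  have [measurable]: "deriv W \<in> borel_measurable borel"
    by (rule borel_measurable_continuous_onI[OF W_cont])
  have nonneg: "0 \<le> ?c * A i t" "0 \<le> ?c * B i t" for i t by (auto simp: A_def B_def)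

  have f_eq: "(LINT y|\<rho> t. dt \<phi> t y) = f t" if t: "t \<in> {0<..<T}" for t
    unfolding \<rho>[OF t] f_def by (subst integral_dirac_sum) auto
  have \<eta>_eq: "\<eta> t = dirac_sum {1..n} (\<lambda>i. ?c * A i t) (x t)"
    and \<zeta>_eq: "\<zeta> t = dirac_sum {1..n} (\<lambda>i. ?c * B i t) (x t)" if t: "t \<in> {0<..<T}" for t
    unfolding \<eta>[OF t] \<zeta>[OF t] by (rule dirac_sum_cong; simp only: A_eq B_eq t)+
  have g_eq: "(LINT z|(\<eta> t \<Otimes>\<^sub>M \<eta> t). (dx \<phi> t (fst z) - dx \<phi> t (snd z)) * dV V (fst z - snd z)) = g t"
    if t: "t \<in> {0<..<T}" for t
    unfolding \<eta>_eq[OF t] g_def using nonneg by (subst integral_pair_dirac_sum) auto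
  have h_eq: "(LINT y|\<eta> t. dx \<phi> t y * (LINT z|\<zeta> t. deriv W (y - z))) = h t"
    if t: "t \<in> {0<..<T}" for t
  proof -
    have "(LINT z|\<zeta> t. deriv W (y - z)) = (\<Sum>j=1..n. ?c * B j t * deriv W (y - x t j))" for y
      unfolding \<zeta>_eq[OF t] using nonneg by (subst integral_dirac_sum) auto
    then have "(LINT y|\<eta> t. dx \<phi> t y * (LINT z|\<zeta> t. deriv W (y - z))) =
        (\<Sum>i=1..n. ?c * A i t * (dx \<phi> t (x t i) * (\<Sum>j=1..n. ?c * B j t * deriv W (x t i - x t j))))"
      unfolding \<eta>_eq[OF t] using nonneg by (simp only:, subst integral_dirac_sum) auto
    also have "\<dots> = h t"
      unfolding h_def sum_distrib_left by (intro sum.cong refl) (simp only: mult_ac)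
    finally show ?thesis .
  qed

  \<comment> \<open>Measurability in time\<close>
  have x_meas [measurable]: "(\<lambda>t. x t i) \<in> borel_measurable ?M" if "i \<in> {1..n}" for i
  proof -
    have "continuous_on {0<..<T} (\<lambda>t. x t i)"
      using cont[OF that] by (rule continuous_on_subset) auto
    from borel_measurable_continuous_on_restrict[OF this]
    show ?thesis by (simp cong: measurable_cong_sets add: measurable_def sets_restrict_space space_restrict_space)
  qed
  have t_meas [measurable]: "(\<lambda>t. t) \<in> borel_measurable ?M"
    by (rule measurable_restrict_space1) simp
  have comp_meas: "(\<lambda>t. F t (x t i)) \<in> borel_measurable ?M"
    if F: "continuous_on UNIV (\<lambda>(t, x). F t x)" and i: "i \<in> {1..n}" for F :: "real \<Rightarrow> real \<Rightarrow> real" and i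
  proof -
    have "(\<lambda>(t, x). F t x) \<in> borel_measurable (borel \<Otimes>\<^sub>M borel)"
      using borel_measurable_continuous_onI[OF F] by (simp add: borel_prod)
    moreover have "(\<lambda>t. (t, x t i)) \<in> ?M \<rightarrow>\<^sub>M borel \<Otimes>\<^sub>M borel"
      using x_meas[OF i] by measurable
    ultimately have "(\<lambda>t. case (t, x t i) of (t, x) \<Rightarrow> F t x) \<in> borel_measurable ?M"
      by (rule measurable_compose[rotated])
    then show ?thesis by simp
  qed
  have AB_meas: "A i \<in> borel_measurable ?M" "B i \<in> borel_measurable ?M" for i
  proof -
    have [measurable]: "{t. ereal t < tau i} \<in> sets borel" by measurable
    have "A i = (\<lambda>t. of_bool (b0 i = p) * indicator {t. ereal t < tau i} t)"
      "B i = (\<lambda>t. of_bool (b0 i = - p) * indicator {t. ereal t < tau i} t)"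
      by (auto simp: A_def B_def fun_eq_iff)
    moreover have "indicator {t. ereal t < tau i} \<in> borel_measurable ?M"
      by (rule measurable_restrict_space1) simp
    ultimately show "A i \<in> borel_measurable ?M" "B i \<in> borel_measurable ?M" by simp_all
  qed

  \<comment> \<open>Uniform bounds on trajectories, test function and kernels\<close>
  have "\<exists>R. \<forall>i\<in>{1..n}. \<forall>t\<in>{0..T}. \<bar>x t i\<bar> \<le> R"
  proof -
    have "\<exists>R. \<forall>t\<in>{0..T}. \<bar>x t i\<bar> \<le> R" if "i \<in> {1..n}" for i
      using compact_imp_bounded[OF compact_continuous_image[OF cont[OF that] compact_Icc]]
      unfolding bounded_iff by auto
    then obtain R where R: "\<And>i t. i \<in> {1..n} \<Longrightarrow> t \<in> {0..T} \<Longrightarrow> \<bar>x t i\<bar> \<le> R i"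
      by metis
    have "\<bar>x t i\<bar> \<le> (\<Sum>k=1..n. \<bar>R k\<bar>)" if "i \<in> {1..n}" "t \<in> {0..T}" for i t
    proof -
      have "\<bar>x t i\<bar> \<le> \<bar>R i\<bar>" using R[OF that] by linarith
      also have "\<dots> \<le> (\<Sum>k=1..n. \<bar>R k\<bar>)" using that by (intro member_le_sum) auto
      finally show ?thesis .
    qed
    then show ?thesis by blast
  qed
  then obtain R where R: "\<And>i t. i \<in> {1..n} \<Longrightarrow> t \<in> {0..T} \<Longrightarrow> \<bar>x t i\<bar> \<le> R" by blast
  have bounded: "\<exists>M. \<forall>t\<in>{0..T}. \<forall>y\<in>{-R..R}. \<bar>F t y\<bar> \<le> M"
    if "continuous_on UNIV (\<lambda>(t, x). F t x)" for F :: "real \<Rightarrow> real \<Rightarrow> real"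
  proof -
    have "compact ({0..T} \<times> {-R..R})" by (intro compact_Times compact_Icc)
    from compact_imp_bounded[OF compact_continuous_image[OF continuous_on_subset[OF that] this]]
    show ?thesis unfolding bounded_iff by force
  qed
  have x_range: "x t i \<in> {-R..R}" if "i \<in> {1..n}" "t \<in> {0<..<T}" for t i
    using R[of i t] that by auto
  obtain M0 where M0: "\<And>t y. t \<in> {0..T} \<Longrightarrow> y \<in> {-R..R} \<Longrightarrow> \<bar>dt \<phi> t y\<bar> \<le> M0"
    using bounded[OF \<phi>_facts(2)] by blast
  obtain M1 where M1: "\<And>t y. t \<in> {0..T} \<Longrightarrow> y \<in> {-R..R} \<Longrightarrow> \<bar>dx \<phi> t y\<bar> \<le> M1"
    using bounded[OF \<phi>_facts(3)] by blast
  obtain M2 where M2: "\<And>t y. t \<in> {0..T} \<Longrightarrow> y \<in> {-R..R} \<Longrightarrow> \<bar>dx (dx \<phi>) t y\<bar> \<le> M2"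
    using bounded[OF \<phi>_facts(4)] by blast
  \<comment> \<open>Differences of two positions in \<open>{-R..R}\<close> range over twice that
    interval.\<close>
  obtain MW where MW: "\<And>y. y \<in> {-(2*R)..2*R} \<Longrightarrow> \<bar>deriv W y\<bar> \<le> MW"
    using compact_imp_bounded[OF compact_continuous_image[OF continuous_on_subset[OF W_cont] compact_Icc]]
    unfolding bounded_iff by fastforce
  obtain C where C: "\<And>r. \<bar>r * dV V r\<bar> \<le> C" using dV_bound[OF adm] by blast
  \<comment> \<open>Mean value bound. The factor \<open>\<bar>y - z\<bar>\<close> gained here turns
    the singular \<open>dV V (y - z)\<close> into the bounded
    \<open>(y - z) * dV V (y - z)\<close>.\<close>
  have dx_lip: "\<bar>dx \<phi> t y - dx \<phi> t z\<bar> \<le> M2 * \<bar>y - z\<bar>"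
    if "t \<in> {0..T}" "y \<in> {-R..R}" "z \<in> {-R..R}" for t y z
    using field_differentiable_bound[of "{-R..R}" "dx \<phi> t" "dx (dx \<phi>) t" M2 y z] that
      DERIV_subset[OF \<phi>_facts(7)] M2 by auto

  \<comment> \<open>Integrability of the three integrands\<close>
  have f_int: "set_integrable lborel {0<..<T} f"
    unfolding f_def
  proof (intro set_integrable_sum set_integrable_mult_right)
    fix i assume i: "i \<in> {i \<in> {1..n}. b0 i = p}"
    show "set_integrable lborel {0<..<T} (\<lambda>t. dt \<phi> t (x t i))"
    proof (rule set_integrable_bounded)
      show "(\<lambda>t. dt \<phi> t (x t i)) \<in> borel_measurable ?M"
        using i by (intro comp_meas \<phi>_facts) simp
      show "\<bar>dt \<phi> t (x t i)\<bar> \<le> M0" if "t \<in> {0<..<T}" for t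
        using M0[of t "x t i"] x_range[of i t] i that by simp
    qed
  qed
  have g_int: "set_integrable lborel {0<..<T} g"
    unfolding g_def
  proof (intro set_integrable_sum)
    fix i j assume ij: "i \<in> {1..n}" "j \<in> {1..n}"
    note [measurable] = x_meas[OF ij(1)] x_meas[OF ij(2)] AB_meas comp_meas[OF \<phi>_facts(3) ij(1)]
      comp_meas[OF \<phi>_facts(3) ij(2)]
    show "set_integrable lborel {0<..<T} (\<lambda>t. ?c * A i t * (?c * A j t) *
      ((dx \<phi> t (x t i) - dx \<phi> t (x t j)) * dV V (x t i - x t j)))"
    proof (rule set_integrable_bounded)
      fix t assume t: "t \<in> {0<..<T}"
      then have "x t i \<in> {-R..R}" "x t j \<in> {-R..R}" using x_range ij by auto
      then have "\<bar>dx \<phi> t (x t i) - dx \<phi> t (x t j)\<bar> * \<bar>dV V (x t i - x t j)\<bar> \<le>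
          M2 * \<bar>x t i - x t j\<bar> * \<bar>dV V (x t i - x t j)\<bar>"
        using t by (intro mult_right_mono dx_lip) auto
      also have "\<dots> \<le> \<bar>M2\<bar> * \<bar>(x t i - x t j) * dV V (x t i - x t j)\<bar>"
        by (simp add: abs_mult mult.assoc mult_right_mono)
      also have "\<dots> \<le> \<bar>M2\<bar> * C"
        by (intro mult_left_mono C) auto
      finally have *: "\<bar>(dx \<phi> t (x t i) - dx \<phi> t (x t j)) * dV V (x t i - x t j)\<bar> \<le> \<bar>M2\<bar> * C"
        by (simp add: abs_mult)
      show "\<bar>?c * A i t * (?c * A j t) * ((dx \<phi> t (x t i) - dx \<phi> t (x t j)) * dV V (x t i - x t j))\<bar>
          \<le> \<bar>?c * ?c\<bar> * (\<bar>M2\<bar> * C)"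
        unfolding abs_mult[of "_ * _ * _"]
        by (intro mult_mono *) (auto simp: A_def)
    qed measurable
  qed
  have h_int: "set_integrable lborel {0<..<T} h"
    unfolding h_def
  proof (intro set_integrable_sum)
    fix i j assume ij: "i \<in> {1..n}" "j \<in> {1..n}"
    note [measurable] = x_meas[OF ij(1)] x_meas[OF ij(2)] AB_meas comp_meas[OF \<phi>_facts(3) ij(1)]
    show "set_integrable lborel {0<..<T} (\<lambda>t. ?c * A i t * (?c * B j t) *
      (dx \<phi> t (x t i) * deriv W (x t i - x t j)))"
    proof (rule set_integrable_bounded)
      fix t assume t: "t \<in> {0<..<T}"
      then have x: "x t i \<in> {-R..R}" "x t j \<in> {-R..R}" using x_range ij by auto
      have "\<bar>dx \<phi> t (x t i)\<bar> \<le> M1" "\<bar>deriv W (x t i - x t j)\<bar> \<le> MW"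
        using x t by (auto intro!: M1 MW)
      then have *: "\<bar>dx \<phi> t (x t i) * deriv W (x t i - x t j)\<bar> \<le> M1 * MW"
        unfolding abs_mult by (intro mult_mono) auto
      show "\<bar>?c * A i t * (?c * B j t) * (dx \<phi> t (x t i) * deriv W (x t i - x t j))\<bar>
          \<le> \<bar>?c * ?c\<bar> * (M1 * MW)"
        unfolding abs_mult[of "_ * _ * _"]
        by (intro mult_mono *) (auto simp: A_def B_def)
    qed measurable
  qed

  \<comment> \<open>Differentiation of the particle sum and integration in time\<close>
  define F where "F = (\<lambda>t. \<Sum>i | i \<in> {1..n} \<and> b0 i = p. ?c * \<phi> t (x t i))"
  \<comment> \<open>Collisions cause no jump: the sum runs over initial charges, so annihilated
    particles stay in it.\<close>
  have F_cont: "continuous_on {0..T} F"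
    unfolding F_def
  proof (intro continuous_intros)
    fix i assume "i \<in> {i \<in> {1..n}. b0 i = p}"
    then have "continuous_on {0..T} (\<lambda>t. (t, x t i))" using cont by (auto intro!: continuous_intros)
    from continuous_on_compose2[OF \<phi>_facts(1) this]
    show "continuous_on {0..T} (\<lambda>t. \<phi> t (x t i))" by simp
  qed
  have F_der: "(F has_real_derivative f t - 1 / 2 * g t - h t) (at t)" if t: "t \<in> {0<..<T} - S" for t
  proof -
    have t': "t \<in> {0<..<T}" using t by simp
    let ?v = "\<lambda>i. - ?c * (\<Sum>j | j \<in> {1..n} \<and> b t i * b t j = 1. dV V (x t i - x t j))
          - ?c * (\<Sum>j | j \<in> {1..n} \<and> b t i * b t j = -1. deriv W (x t i - x t j))"
    \<comment> \<open>An annihilated particle has \<open>b t i = 0\<close>, so both sums in its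
      velocity are empty, in accordance with \<open>A i t = 0\<close>.\<close>
    have v: "?v i = - ?c * (\<Sum>j=1..n. A i t * A j t * dV V (x t i - x t j))
          - ?c * (\<Sum>j=1..n. A i t * B j t * deriv W (x t i - x t j))"
      if i: "i \<in> {1..n}" "b0 i = p" for i
    proof -
      have "A i t * A j t = of_bool (b t i * b t j = 1)" "A i t * B j t = of_bool (b t i * b t j = -1)"
        if "j \<in> {1..n}" for j
        using b[OF t' i(1)] b[OF t' that] b_cases[OF that] i pp by (auto simp: A_def B_def)
      then show ?thesis
        by (intro arg_cong2[where f = "(-)"] arg_cong2[where f = "(*)"] refl sum.mono_neutral_cong_left) auto
    qed
    have outside: "A i t = 0" if "i \<in> {1..n} - {i \<in> {1..n}. b0 i = p}" for i
      using that by (auto simp: A_def)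
    \<comment> \<open>Exchanging the summation indices moves \<open>dx \<phi>\<close> from
      \<open>x t j\<close> to \<open>x t i\<close>, and oddness of \<open>dV V\<close> produces the
      sign.\<close>
    have antisym: "(\<Sum>i=1..n. \<Sum>j=1..n. A i t * A j t * dx \<phi> t (x t j) * dV V (x t i - x t j)) =
        - (\<Sum>i=1..n. \<Sum>j=1..n. A i t * A j t * dx \<phi> t (x t i) * dV V (x t i - x t j))"
    proof -
      have "dV V (x t i - x t j) = - dV V (x t j - x t i)" for i j
        using dV_minus[OF adm, of "x t j - x t i"] by simp
      then have "(\<Sum>i=1..n. \<Sum>j=1..n. A i t * A j t * dx \<phi> t (x t j) * dV V (x t i - x t j)) =
          - (\<Sum>i=1..n. \<Sum>j=1..n. A j t * A i t * dx \<phi> t (x t j) * dV V (x t j - x t i))"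
        unfolding sum_negf[symmetric] by (intro sum.cong refl) (metis mult.commute mult_minus_right)
      then show ?thesis by (subst sum.swap) simp
    qed
    have "(F has_real_derivative
        (\<Sum>i | i \<in> {1..n} \<and> b0 i = p. ?c * (dt \<phi> t (x t i) + dx \<phi> t (x t i) * ?v i))) (at t)"
      unfolding F_def
      by (intro DERIV_sum DERIV_cmult test_function_chain_rule[OF \<phi>] der[OF t]) auto
    also have "(\<Sum>i | i \<in> {1..n} \<and> b0 i = p. ?c * (dt \<phi> t (x t i) + dx \<phi> t (x t i) * ?v i)) =
        f t + (\<Sum>i | i \<in> {1..n} \<and> b0 i = p. ?c * dx \<phi> t (x t i) * ?v i)"
      unfolding f_def sum.distrib[symmetric] by (intro sum.cong refl) (simp only: algebra_simps)
    also have "(\<Sum>i | i \<in> {1..n} \<and> b0 i = p. ?c * dx \<phi> t (x t i) * ?v i) =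
        (\<Sum>i=1..n. ?c * dx \<phi> t (x t i) *
          (- ?c * (\<Sum>j=1..n. A i t * A j t * dV V (x t i - x t j))
          - ?c * (\<Sum>j=1..n. A i t * B j t * deriv W (x t i - x t j))))"
      using v outside by (intro sum.mono_neutral_cong_left) auto
    also have "\<dots> = - (?c * ?c * (\<Sum>i=1..n. \<Sum>j=1..n. A i t * A j t * dx \<phi> t (x t i) * dV V (x t i - x t j))) - h t"
      unfolding h_def sum_distrib_left sum_negf[symmetric] sum_subtractf[symmetric] right_diff_distrib
      by (intro sum.cong refl) (simp only: mult_ac mult_minus_left mult_minus_right)
    \<comment> \<open>By \<open>antisym\<close> both terms of the difference in \<open>g\<close>
      contribute equally, which is the origin of the factor 1/2.\<close>
    also have "?c * ?c * (\<Sum>i=1..n. \<Sum>j=1..n. A i t * A j t * dx \<phi> t (x t i) * dV V (x t i - x t j)) = 1 / 2 * g t"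
    proof -
      have "g t = ?c * ?c * ((\<Sum>i=1..n. \<Sum>j=1..n. A i t * A j t * dx \<phi> t (x t i) * dV V (x t i - x t j))
          - (\<Sum>i=1..n. \<Sum>j=1..n. A i t * A j t * dx \<phi> t (x t j) * dV V (x t i - x t j)))"
        unfolding g_def sum_distrib_left sum_subtractf[symmetric]
        by (intro sum.cong refl) (simp only: algebra_simps)
      then show ?thesis unfolding antisym by simp
    qed
    finally show ?thesis by (simp add: algebra_simps)
  qed
  \<comment> \<open>Continuity of \<open>F\<close> bridges the finitely many times in
    \<open>S\<close>. Both \<open>F 0\<close> and \<open>F T\<close> vanish with the test
    function.\<close>
  have "((\<lambda>t. f t - 1 / 2 * g t - h t) has_integral F T - F 0) {0..T}"
    using F_der F_cont S T
    by (intro fundamental_theorem_of_calculus_interior_strong[of S])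
      (auto simp: has_real_derivative_iff_has_vector_derivative)
  then have "integral {0<..<T} (\<lambda>t. f t - 1 / 2 * g t - h t) = 0"
    by (simp add: F_def \<phi>_facts(8,9) has_integral_Icc_iff_Ioo integral_unique)
  moreover have "(LBINT t:{0<..<T}. f t - 1 / 2 * g t - h t) =
      (LBINT t:{0<..<T}. f t) - 1 / 2 * (LBINT t:{0<..<T}. g t) - (LBINT t:{0<..<T}. h t)"
    using f_int g_int h_int by (simp add: set_integral_diff)
  \<comment> \<open>The fundamental theorem yields a gauge integral; integrability in the Lebesgue
    sense identifies it with the integral of the weak equation.\<close>
  moreover have "set_integrable lborel {0<..<T} (\<lambda>t. f t - 1 / 2 * g t - h t)"
    using f_int g_int h_int by (intro set_integral_diff set_integrable_mult_right)
  ultimately have "0 = (LBINT t:{0<..<T}. f t) - 1 / 2 * (LBINT t:{0<..<T}. g t) - (LBINT t:{0<..<T}. h t)"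
    using set_borel_integral_eq_integral(2) by metis
  also have "(LBINT t:{0<..<T}. f t) = (LBINT t:{0<..<T}. (LINT y|\<rho> t. dt \<phi> t y))"
    using f_eq by (intro set_lebesgue_integral_cong) auto
  also have "(LBINT t:{0<..<T}. g t) = (LBINT t:{0<..<T}. (LINT z|(\<eta> t \<Otimes>\<^sub>M \<eta> t).
      (dx \<phi> t (fst z) - dx \<phi> t (snd z)) * dV V (fst z - snd z)))"
    using g_eq by (intro set_lebesgue_integral_cong) auto
  also have "(LBINT t:{0<..<T}. h t) = (LBINT t:{0<..<T}. (LINT y|\<eta> t.
      dx \<phi> t y * (LINT z|\<zeta> t. deriv W (y - z))))"
    using h_eq by (intro set_lebesgue_integral_cong) auto
  finally show "0 = (LBINT t:{0<..<T}. (LINT x|\<rho> t. dt \<phi> t x))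
          - 1 / 2 * (LBINT t:{0<..<T}. (LINT z|(\<eta> t \<Otimes>\<^sub>M \<eta> t).
               (dx \<phi> t (fst z) - dx \<phi> t (snd z)) * dV V (fst z - snd z)))
          - (LBINT t:{0<..<T}. (LINT x|\<eta> t. dx \<phi> t x * (LINT y|\<zeta> t. deriv W (x - y))))" .
qed

section \<open>The particle system as a continuum solution\<close>

text \<open>A constant \<open>K\<close> serves as the dominating function; on a bounded interval its
  powers are integrable for every exponent, so one lemma gives both AC and AC^2.\<close>

lemma AC_curve_Lipschitz:
  assumes X: "\<And>t. t \<in> {0<..<T} \<Longrightarrow> \<mu> t \<in> X" and K: "K \<ge> 0"
    and lip: "\<And>s t. s \<in> {0<..<T} \<Longrightarrow> t \<in> {0<..<T} \<Longrightarrow> wasserstein (\<mu> s) (\<mu> t) \<le> K * \<bar>s - t\<bar>"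
  shows "AC_curve p T X \<mu>"
  unfolding AC_curve_def
proof (intro conjI exI[of _ "\<lambda>_. K"] ballI allI impI)
  show "set_integrable lborel {0<..<T} (\<lambda>r. \<bar>K\<bar> powr p)"
    by (rule set_integrable_bounded[of _ _ _ "\<bar>K\<bar> powr p"]) auto
  show "wasserstein (\<mu> s) (\<mu> t) \<le> (LBINT r:{s..t}. \<bar>K\<bar>)" if "0 < s \<and> s \<le> t \<and> t < T" for s t
    using lip[of s t] that K by (simp add: set_lebesgue_integral_def mult.commute)
qed (use X in \<open>auto simp: set_borel_measurable_def\<close>)

text \<open>The bound on the metric derivative is claimed where every trajectory is differentiable,
  so that its right-hand side has a meaning; existence of the limit is part of the claim. Only
  collision times can be exceptions.\<close>

theorem proposition4p6:
  fixes V W :: "real \<Rightarrow> real" and n :: nat and T :: real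
    and x0 :: "nat \<Rightarrow> real" and b0 :: "nat \<Rightarrow> int"
    and x :: "real \<Rightarrow> nat \<Rightarrow> real" and b :: "real \<Rightarrow> nat \<Rightarrow> int"
  assumes "admissible_potentials V W"
    and "n \<ge> 2" and "T > 0"
    and "\<forall>i\<in>{1..n}. b0 i \<in> {-1, 1}"
    and "strict_mono_on {1..n} x0"
    and "discrete_solution V W n T x0 b0 x b"
  shows
    "(\<forall>t\<in>{0..<T}.
        pos_part (signed_empirical n b0 (x t)) =
          dirac_sum {1..n} (\<lambda>i. (1 / real n) * of_int (max 0 (b t i))) (x t) \<and>
        neg_part (signed_empirical n b0 (x t)) =
          dirac_sum {1..n} (\<lambda>i. (1 / real n) * of_int (max 0 (- b t i))) (x t))
     \<and> AC_curve 2 T (P2m (real (card {i \<in> {1..n}. b0 i = 1}) / real n))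
         (\<lambda>t. empirical n b0 (x t))
     \<and> (\<forall>t\<in>{0<..<T}. (\<forall>i\<in>{1..n}. (\<lambda>s. x s i) differentiable (at t)) \<longrightarrow>
          (\<exists>D. has_metric_derivative (\<lambda>t. empirical n b0 (x t)) D t \<and>
               D\<^sup>2 \<le> (1 / real n) * (\<Sum>i=1..n. (deriv (\<lambda>s. x s i) t)\<^sup>2)))
     \<and> continuum_solution V W T (empirical n b0 x0) (\<lambda>t. empirical n b0 (x t))"
proof -
  note adm = assms(1) and T = assms(3) and sol = assms(6)
  have n: "n > 0" using assms(2) by simp
  have b0: "b0 i \<in> {-1, 1}" if "i \<in> {1..n}" for i using assms(4) that by blast
  have init: "x 0 i = x0 i" if "i \<in> {1..n}" for i
    using sol that unfolding discrete_solution_def by blast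
  have b_range: "b t i \<in> {-1, 0, 1}" if "t \<in> {0..T}" "i \<in> {1..n}" for t i
    using sol that unfolding discrete_solution_def by blast
  have "\<exists>L. L-lipschitz_on {0..T} (\<lambda>t. x t i)" if "i \<in> {1..n}" for i
    using sol that unfolding discrete_solution_def by blast
  then obtain L where L: "\<And>i. i \<in> {1..n} \<Longrightarrow> (L i)-lipschitz_on {0..T} (\<lambda>t. x t i)"
    by metis
  have inj: "inj_on x0 {1..n}" using assms(5) by (rule strict_mono_on_imp_inj_on)
  obtain tau S where S: "finite S"
    and b: "\<And>s i. s \<in> {0..T} \<Longrightarrow> i \<in> {1..n} \<Longrightarrow> b s i = b0 i * of_bool (ereal s < tau i)"
    and sep: "\<And>s i j. s \<in> {0..<T} \<Longrightarrow> i \<in> {1..n} \<Longrightarrow> j \<in> {1..n} \<Longrightarrow> b s i * b s j = -1 \<Longrightarrow> x s i \<noteq> x s j"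
    and cancel: "\<And>s (f :: real \<Rightarrow> real). s \<in> {0..T} \<Longrightarrow>
       (\<Sum>i=1..n. of_int (b0 i) * f (x s i)) = (\<Sum>i=1..n. of_int (b s i) * f (x s i))"
    and der: "\<And>s i. s \<in> {0<..<T} - S \<Longrightarrow> i \<in> {1..n} \<Longrightarrow>
       ((\<lambda>r. x r i) has_real_derivative
          - (1 / real n) * (\<Sum>j | j \<in> {1..n} \<and> b s i * b s j = 1. dV V (x s i - x s j))
          - (1 / real n) * (\<Sum>j | j \<in> {1..n} \<and> b s i * b s j = -1. deriv W (x s i - x s j))) (at s)"
    by (rule discrete_solution_facts[OF sol T assms(4) inj]) (rule that)

  \<comment> \<open>Stated for any set function agreeing with \<open>signed_empirical\<close> on
    Borel sets, so that it also applies to \<open>signed_difference\<close> in the weak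
    equation.\<close>
  have pos: "pos_part \<kappa> = dirac_sum {1..n} (\<lambda>i. (1 / real n) * of_int (max 0 (b t i))) (x t)"
    and neg: "neg_part \<kappa> = dirac_sum {1..n} (\<lambda>i. (1 / real n) * of_int (max 0 (- b t i))) (x t)"
    if t: "t \<in> {0..<T}" and \<kappa>: "\<And>A. A \<in> sets borel \<Longrightarrow> \<kappa> A = signed_empirical n b0 (x t) A" for t \<kappa>
  proof -
    have t': "t \<in> {0..T}" using t by simp
    \<comment> \<open>Cancellation with the indicator of \<open>A\<close> replaces initial charges
      by current ones, whose opposite signs are separated.\<close>
    have \<kappa>': "\<kappa> A = (\<Sum>i=1..n. (1 / real n) * of_int (b t i) * indicator A (x t i))"
      if "A \<in> sets borel" for A
      unfolding \<kappa>[OF that] signed_empirical_def cancel[OF t', of "indicator A"] sum_distrib_left mult.assoc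
      by (rule refl)
    show "pos_part \<kappa> = dirac_sum {1..n} (\<lambda>i. (1 / real n) * of_int (max 0 (b t i))) (x t)"
      by (rule pos_part_particles) (fact \<kappa>' | fact sep[OF t] | fact b_range[OF t'])+
    show "neg_part \<kappa> = dirac_sum {1..n} (\<lambda>i. (1 / real n) * of_int (max 0 (- b t i))) (x t)"
      unfolding neg_part_def
    proof (rule pos_part_particles)
      show "- \<kappa> A = (\<Sum>i=1..n. (1 / real n) * of_int (- b t i) * indicator A (x t i))"
        if "A \<in> sets borel" for A
        unfolding \<kappa>'[OF that] sum_negf[symmetric] by (intro sum.cong) simp_all
      show "x t i \<noteq> x t j" if "i \<in> {1..n}" "j \<in> {1..n}" "- b t i * - b t j = -1" for i j
        using sep[OF t that(1,2)] that(3) by simp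
      show "- b t i \<in> {-1, 0, 1}" if "i \<in> {1..n}" for i
        using b_range[OF t' that] by auto
    qed
  qed

  \<comment> \<open>Under the identity pairing the individual Lipschitz constants combine into their
    root mean square.\<close>
  define K where "K = sqrt (1 / real n * (\<Sum>i=1..n. (L i)\<^sup>2))"
  have "K \<ge> 0" by (simp add: K_def sum_nonneg)
  have lip: "wasserstein (empirical n b0 (x s)) (empirical n b0 (x t)) \<le> K * \<bar>s - t\<bar>"
    if st: "s \<in> {0..T}" "t \<in> {0..T}" for s t
  proof -
    have "(x s i - x t i)\<^sup>2 \<le> (L i)\<^sup>2 * (s - t)\<^sup>2" if i: "i \<in> {1..n}" for i
    proof -
      have "\<bar>x s i - x t i\<bar> \<le> L i * \<bar>s - t\<bar>"
        using lipschitz_onD[OF L[OF i] st] by (simp add: dist_real_def)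
      then have "\<bar>x s i - x t i\<bar>\<^sup>2 \<le> (L i * \<bar>s - t\<bar>)\<^sup>2"
        by (intro power_mono) auto
      then show ?thesis by (simp add: power_mult_distrib)
    qed
    then have "1 / real n * (\<Sum>i=1..n. (x s i - x t i)\<^sup>2) \<le> 1 / real n * (\<Sum>i=1..n. (L i)\<^sup>2 * (s - t)\<^sup>2)"
      by (intro mult_left_mono sum_mono) auto
    also have "\<dots> = 1 / real n * (\<Sum>i=1..n. (L i)\<^sup>2) * (s - t)\<^sup>2"
      by (simp add: sum_distrib_right)
    finally have "sqrt (1 / real n * (\<Sum>i=1..n. (x s i - x t i)\<^sup>2)) \<le> K * \<bar>s - t\<bar>"
      unfolding K_def real_sqrt_abs[symmetric] real_sqrt_mult[symmetric] by (rule real_sqrt_le_mono)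
    then show ?thesis
      using wasserstein_empirical_le[of n b0 "x s" "x t"] b0 by (meson order_trans)
  qed

  let ?m = "real (card {i \<in> {1..n}. b0 i = 1}) / real n"
  have P2m: "empirical n b0 y \<in> P2m ?m" for y
    using b0 n by (rule empirical_in_P2m)
  have AC: "AC_curve p T (P2m ?m) (\<lambda>t. empirical n b0 (x t))" for p
    by (rule AC_curve_Lipschitz[OF P2m \<open>K \<ge> 0\<close>]) (auto intro: lip)

  have metric: "\<exists>D. has_metric_derivative (\<lambda>t. empirical n b0 (x t)) D t \<and>
      D\<^sup>2 \<le> (1 / real n) * (\<Sum>i=1..n. (deriv (\<lambda>s. x s i) t)\<^sup>2)"
    if diff: "\<forall>i\<in>{1..n}. (\<lambda>s. x s i) differentiable (at t)" for t
  proof (intro exI conjI)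
    show "has_metric_derivative (\<lambda>t. empirical n b0 (x t))
        (sqrt (1 / real n * (\<Sum>i=1..n. (deriv (\<lambda>s. x s i) t)\<^sup>2))) t"
      using b0 by (rule metric_derivative_empirical)
        (use diff in \<open>simp_all add: DERIV_deriv_iff_real_differentiable\<close>)
    show "(sqrt (1 / real n * (\<Sum>i=1..n. (deriv (\<lambda>s. x s i) t)\<^sup>2)))\<^sup>2 \<le>
        1 / real n * (\<Sum>i=1..n. (deriv (\<lambda>s. x s i) t)\<^sup>2)"
      by (simp add: sum_nonneg)
  qed

  have x_cont: "continuous_on {0..T} (\<lambda>t. x t i)" if "i \<in> {1..n}" for i
    using L[OF that] by (rule lipschitz_on_continuous_on)
  have x_init: "empirical n b0 (x 0) = empirical n b0 x0"
    unfolding empirical_def using init by (auto intro!: dirac_sum_cong)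
  \<comment> \<open>The Lipschitz estimate includes the end point 0, where the curve takes the
    initial value.\<close>
  have init_lim: "((\<lambda>t. wasserstein (empirical n b0 (x t)) (empirical n b0 x0)) \<longlongrightarrow> 0) (at_right 0)"
  proof (rule tendsto_sandwich)
    show "\<forall>\<^sub>F t in at_right 0. 0 \<le> wasserstein (empirical n b0 (x t)) (empirical n b0 x0)"
      by (simp add: wasserstein_def)
    show "\<forall>\<^sub>F t in at_right 0. wasserstein (empirical n b0 (x t)) (empirical n b0 x0) \<le> K * t"
      using lip[of _ 0] T by (intro eventually_at_rightI[of 0 T]) (auto simp: x_init)
    show "((\<lambda>t. K * t) \<longlongrightarrow> 0) (at_right 0)"
      by (auto intro!: tendsto_eq_intros)
  qed simp
  let ?\<kappa> = "\<lambda>t. signed_difference (empirical n b0 (x t))"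
  have pos': "pos_part (?\<kappa> t) = dirac_sum {1..n} (\<lambda>i. (1 / real n) * of_int (max 0 (b t i))) (x t)"
    and neg': "neg_part (?\<kappa> t) = dirac_sum {1..n} (\<lambda>i. (1 / real n) * of_int (max 0 (- b t i))) (x t)"
    if "t \<in> {0<..<T}" for t
  proof -
    have t: "t \<in> {0..<T}" using that by simp
    have eq: "?\<kappa> t A = signed_empirical n b0 (x t) A" if "A \<in> sets borel" for A
      using b0 that by (rule signed_difference_empirical)
    show "pos_part (?\<kappa> t) = dirac_sum {1..n} (\<lambda>i. (1 / real n) * of_int (max 0 (b t i))) (x t)"
      by (rule pos[OF t eq])
    show "neg_part (?\<kappa> t) = dirac_sum {1..n} (\<lambda>i. (1 / real n) * of_int (max 0 (- b t i))) (x t)"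
      by (rule neg[OF t eq])
  qed
  have b': "b t i = b0 i * of_bool (ereal t < tau i)" if "t \<in> {0<..<T}" "i \<in> {1..n}" for t i
    using b[of t i] that by simp
  have weak: "weak_equation V W T \<rho> \<eta> \<zeta>"
    if "p \<in> {-1, 1}"
      and "\<And>t. t \<in> {0<..<T} \<Longrightarrow> \<rho> t = dirac_sum {i \<in> {1..n}. b0 i = p} (\<lambda>_. 1 / real n) (x t)"
      and "\<And>t. t \<in> {0<..<T} \<Longrightarrow> \<eta> t = dirac_sum {1..n} (\<lambda>i. (1 / real n) * of_int (max 0 (p * b t i))) (x t)"
      and "\<And>t. t \<in> {0<..<T} \<Longrightarrow> \<zeta> t = dirac_sum {1..n} (\<lambda>i. (1 / real n) * of_int (max 0 (- p * b t i))) (x t)"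
    for p :: int and \<rho> \<eta> \<zeta>
    using adm T that(1) b0 b' x_cont S der that(2-4) by (rule weak_equation_particles)
  have "weak_equation V W T (\<lambda>t. fst (empirical n b0 (x t))) (\<lambda>t. pos_part (?\<kappa> t)) (\<lambda>t. neg_part (?\<kappa> t))"
  proof (rule weak[of "1"])
    show "fst (empirical n b0 (x t)) = dirac_sum {i \<in> {1..n}. b0 i = 1} (\<lambda>_. 1 / real n) (x t)" for t
      by (simp add: empirical_def)
    show "pos_part (?\<kappa> t) = dirac_sum {1..n} (\<lambda>i. (1 / real n) * of_int (max 0 (1 * b t i))) (x t)"
      if "t \<in> {0<..<T}" for t
      using pos'[OF that] by simp
    show "neg_part (?\<kappa> t) = dirac_sum {1..n} (\<lambda>i. (1 / real n) * of_int (max 0 (- 1 * b t i))) (x t)"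
      if "t \<in> {0<..<T}" for t
      using neg'[OF that] by simp
  qed simp
  moreover have "weak_equation V W T (\<lambda>t. snd (empirical n b0 (x t))) (\<lambda>t. neg_part (?\<kappa> t)) (\<lambda>t. pos_part (?\<kappa> t))"
  \<comment> \<open>For \<open>p = -1\<close> the positive and negative parts exchange their roles
    as \<eta> and \<zeta>.\<close>
  proof (rule weak[of "-1"])
    show "snd (empirical n b0 (x t)) = dirac_sum {i \<in> {1..n}. b0 i = -1} (\<lambda>_. 1 / real n) (x t)" for t
      by (simp add: empirical_def)
    show "neg_part (?\<kappa> t) = dirac_sum {1..n} (\<lambda>i. (1 / real n) * of_int (max 0 (-1 * b t i))) (x t)"
      if "t \<in> {0<..<T}" for t
      using neg'[OF that] by simp
    show "pos_part (?\<kappa> t) = dirac_sum {1..n} (\<lambda>i. (1 / real n) * of_int (max 0 (- (- 1) * b t i))) (x t)"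
      if "t \<in> {0<..<T}" for t
      using pos'[OF that] by simp
  qed simp
  moreover have "empirical n b0 x0 \<in> P2" "measure (fst (empirical n b0 x0)) UNIV = ?m"
    using P2m[of x0] by (simp_all add: P2m_def)
  ultimately have "continuum_solution V W T (empirical n b0 x0) (\<lambda>t. empirical n b0 (x t))"
    unfolding continuum_solution_def using AC x_init init_lim by simp
  then show ?thesis
    using pos neg AC metric by simp
qed

end
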